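(* Let $((X^n(t))_{t\in[0,T]})_{n\in\mathbb{N}}$ be a family of $p$-dimensional, continuous, centered Gaussian processes, starting from zero, with independent components, which satisfies an LDP on $C([0,T],\mathbb{R}^p)$ with speed $\gamma_n$ and good rate function $$I(h)=\sum_{i=1}^p I_i(h_i),\qquad I_i(h_i)=\begin{cases}\frac12\|h_i\|^2_{\mathscr{H}_i} & h_i\in\mathscr{H}_i\\ +\infty & h_i\notin\mathscr{H}_i,\end{cases}$$ where $\mathscr{H}_i\subset C([0,T],\mathbb{R})$ is the reproducing kernel Hilbert space associated to some covariance function $k_{ii}$. Let $((A^n,B^n))_{n\in\mathbb{N}}$ be a $[0,+\infty)\times C([0,T],\mathbb{R}^p)$-valued random sequence (so $A^n$ is a $[0,+\infty)$-valued random variable and $B^n$ is a continuous $\mathbb{R}^p$-valued process), independent of $(X^n)_{n\in\mathbb{N}}$, which satisfies an LDP with speed $\gamma_n$ and good rate function $I_{(A,B)}$. Set $$Z^n=A^nX^n+B^n\quad(n\in\mathbb{N}),$$ i.e. $Z^n(t)=A^nX^n(t)+B^n(t)$ for $t\in[0,T]$. Then $((A^n,B^n),Z^n)_{n\in\mathbb{N}}$ satisfies an LDP with speed $\gamma_n$ and rate function $$I_{(A,B),Z}((a,b),z)=I_{(A,B)}(a,b)+\sum_{i=1}^pJ_i(z_i|(a,b_i)),$$ where $$J_i(z_i|(a,b_i))=\begin{cases}\frac{1}{2a^2}\|z_i-b_i\|^2_{\mathscr{H}_i} & a>0\\ 0 & z_i-b_i=0\text{ and }a=0\\ +\infty&\text{otherwise.}\end{cases}$$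 Moreover $(Z^n)_{n\in\mathbb{N}}$ satisfies an LDP with speed $\gamma_n$ and the good rate function $$I_Z(z)=\inf_{(a,b)\in[0,+\infty)\times C([0,T],\mathbb{R}^p)}\Big\{I_{(A,B)}(a,b)+\sum_{i=1}^pJ_i(z_i|(a,b_i))\Big\}.$$
   Context: $T>0$ and $p\ge1$ are fixed. $C([0,T],\mathbb{R}^p)$ carries the sup-norm $\|f\|_\infty=\sup_{0\le t\le T}\|f(t)\|$ ($\|\cdot\|$ Euclidean); product spaces carry the product topology. Large deviation principle (LDP): let $E$ be a topological space with Borel $\sigma$-algebra and $\gamma_n>0$ with $\gamma_n\to+\infty$ (the speed). A rate function is a lower semicontinuous $I:E\to[0,+\infty]$; it is good if $\{I\le a\}$ is compact for all $a\ge0$. Probability measures $(\mu_n)$ satisfy the LDP on $E$ with rate function $I$ and speed $\gamma_n$ if $\liminf_n\frac1{\gamma_n}\log\mu_n(\Theta)\ge-\inf_{x\in\Theta}I(x)$ for every open $\Theta$ and $\limsup_n\frac1{\gamma_n}\log\mu_n(\Gamma)\le-\inf_{x\in\Gamma}I(x)$ for every closed $\Gamma$. Random elements satisfy an LDP if their laws do. Reproducing kernel Hilbert space (RKHS): let $U=(U(t))_{t\in[0,T]}$ be a real continuous centered Gaussian process with covariance function $k$. Let $H$ be the $L^2$-closure of $\{\int_0^TU(t)\,d\lambda(t):\lambda\text{ a signed measure on }[0,T]\}$. The RKHS of $k$ is $\mathscr{H}=\{h: h(t)=\mathbb{E}[U(t)Y],\ Y\in H\}\subset C([0,T],\mathbb{R})$,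 with inner product transported from $L^2$ by the bijection $Y\mapsto\mathbb{E}[U(\cdot)Y]$. Equivalently it is the completion of the functions $x(t)=\int_0^Tk(t,s)\,d\lambda(s)$ under $\|x\|^2=\int_0^T\int_0^Tk(t,s)\,d\lambda(t)\,d\lambda(s)$. Convention: $\|h\|^2_{\mathscr{H}_i}=+\infty$ if $h\notin\mathscr{H}_i$. *)

theory Defs
  imports "HOL-Probability.Probability"
begin

section \<open>Large deviation principles\<close>

definition borel_of :: "'a topology \<Rightarrow> 'a measure" where
  "borel_of X = sigma (topspace X) {S. openin X S}"

text \<open>Rate functions take values in \<open>ennreal\<close>, i.e. in the interval from 0 to infinity; their
  values outside the carrier of the topology are irrelevant.\<close>

definition rate_function :: "'a topology \<Rightarrow> ('a \<Rightarrow> ennreal) \<Rightarrow> bool" where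
  "rate_function X I \<longleftrightarrow> (\<forall>a. openin X {x \<in> topspace X. a < I x})"

definition good_rate_function :: "'a topology \<Rightarrow> ('a \<Rightarrow> ennreal) \<Rightarrow> bool" where
  "good_rate_function X I \<longleftrightarrow> rate_function X I \<and>
     (\<forall>a\<ge>0. compactin X {x \<in> topspace X. I x \<le> ennreal a})"

text \<open>Logarithm with the convention that the logarithm of 0 is minus infinity
  (the library has \<open>ln 0 = 0\<close>).\<close>

definition ext_ln :: "real \<Rightarrow> ereal" where
  "ext_ln x = (if x = 0 then -\<infinity> else ereal (ln x))"

definition ldp :: "'a topology \<Rightarrow> (nat \<Rightarrow> real) \<Rightarrow> (nat \<Rightarrow> 'a measure) \<Rightarrow> ('a \<Rightarrow> ennreal) \<Rightarrow> bool" where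
  "ldp X \<gamma> \<mu> I \<longleftrightarrow>
     (\<forall>n. \<gamma> n > 0) \<and> filterlim \<gamma> at_top sequentially \<and>
     (\<forall>n. prob_space (\<mu> n) \<and> sets (\<mu> n) = sets (borel_of X)) \<and>
     rate_function X I \<and>
     (\<forall>\<Theta>. openin X \<Theta> \<longrightarrow>
        liminf (\<lambda>n. ereal (1 / \<gamma> n) * ext_ln (measure (\<mu> n) \<Theta>)) \<ge> - enn2ereal (INF x\<in>\<Theta>. I x)) \<and>
     (\<forall>\<Gamma>. closedin X \<Gamma> \<longrightarrow>
        limsup (\<lambda>n. ereal (1 / \<gamma> n) * ext_ln (measure (\<mu> n) \<Gamma>)) \<le> - enn2ereal (INF x\<in>\<Gamma>. I x))"

definition ldp_elements ::
  "'w measure \<Rightarrow> 'a topology \<Rightarrow> (nat \<Rightarrow> real) \<Rightarrow> (nat \<Rightarrow> 'w \<Rightarrow> 'a) \<Rightarrow> ('a \<Rightarrow> ennreal) \<Rightarrow> bool" where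
  "ldp_elements M X \<gamma> Y I \<longleftrightarrow>
     (\<forall>n. Y n \<in> measurable M (borel_of X)) \<and> ldp X \<gamma> (\<lambda>n. distr M (borel_of X) (Y n)) I"

text \<open>Independence of two random elements with values of different types (the library's
  \<open>indep_var\<close> needs equal types): the generated sigma-algebras are independent.\<close>

definition indep_elements ::
  "'w measure \<Rightarrow> 'a measure \<Rightarrow> ('w \<Rightarrow> 'a) \<Rightarrow> 'b measure \<Rightarrow> ('w \<Rightarrow> 'b) \<Rightarrow> bool" where
  "indep_elements M S F R G \<longleftrightarrow>
     prob_space.indep_set M (sets (vimage_algebra (space M) F S)) (sets (vimage_algebra (space M) G R))"


section \<open>Spaces of continuous paths\<close>

text \<open>Paths on the interval from 0 to \<open>T\<close> are extensional functions on \<open>real\<close>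
  (equal to \<open>undefined\<close> off the interval); the metric of \<open>cfunspace\<close> is the sup-distance.\<close>

definition path_top :: "real \<Rightarrow> (real \<Rightarrow> 'b::euclidean_space) topology" where
  "path_top T = mtopology_of (cfunspace (top_of_set {0..T}) euclidean_metric)"

definition path_comp :: "real \<Rightarrow> (real \<Rightarrow> real ^ 'p) \<Rightarrow> 'p \<Rightarrow> real \<Rightarrow> real" where
  "path_comp T f i = (\<lambda>t\<in>{0..T}. f t $ i)"

definition scale_path_top :: "real \<Rightarrow> (real \<times> (real \<Rightarrow> real ^ 'p)) topology" where
  "scale_path_top T = prod_topology (top_of_set {0..}) (path_top T)"


section \<open>Gaussian processes\<close>

text \<open>The Dirac mass at 0 counts as a (degenerate) centered Gaussian law.\<close>

definition centered_gaussian :: "'w measure \<Rightarrow> ('w \<Rightarrow> real) \<Rightarrow> bool" where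
  "centered_gaussian M Y \<longleftrightarrow> Y \<in> borel_measurable M \<and>
     (distr M borel Y = return borel 0 \<or>
      (\<exists>\<sigma>>0. distr M borel Y = density lborel (\<lambda>x. ennreal (normal_density 0 \<sigma> x))))"

text \<open>All finite-dimensional distributions are centered Gaussian, i.e. every linear functional of
  finitely many values is centered Gaussian.\<close>

definition centered_gaussian_process ::
  "'w measure \<Rightarrow> real \<Rightarrow> ('w \<Rightarrow> real \<Rightarrow> 'b::euclidean_space) \<Rightarrow> bool" where
  "centered_gaussian_process M T X \<longleftrightarrow>
     (\<forall>t\<in>{0..T}. (\<lambda>\<omega>. X \<omega> t) \<in> borel_measurable M) \<and>
     (\<forall>F c. finite F \<longrightarrow> F \<subseteq> {0..T} \<longrightarrow> centered_gaussian M (\<lambda>\<omega>. \<Sum>t\<in>F. c t \<bullet> X \<omega> t))"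

definition continuous_gaussian_process ::
  "'w measure \<Rightarrow> real \<Rightarrow> ('w \<Rightarrow> real \<Rightarrow> 'b::euclidean_space) \<Rightarrow> bool" where
  "continuous_gaussian_process M T X \<longleftrightarrow>
     prob_space M \<and> centered_gaussian_process M T X \<and> (\<forall>\<omega>\<in>space M. continuous_on {0..T} (X \<omega>))"

definition independent_components ::
  "'w measure \<Rightarrow> real \<Rightarrow> ('w \<Rightarrow> real \<Rightarrow> real ^ 'p) \<Rightarrow> bool" where
  "independent_components M T X \<longleftrightarrow>
     prob_space.indep_vars M (\<lambda>i::'p. borel_of (path_top T)) (\<lambda>i \<omega>. path_comp T (X \<omega>) i) UNIV"

definition has_covariance ::
  "'w measure \<Rightarrow> real \<Rightarrow> ('w \<Rightarrow> real \<Rightarrow> real) \<Rightarrow> (real \<Rightarrow> real \<Rightarrow> real) \<Rightarrow> bool" where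
  "has_covariance N T U k \<longleftrightarrow>
     (\<forall>s\<in>{0..T}. \<forall>t\<in>{0..T}. k s t = (\<integral>\<omega>. U \<omega> s * U \<omega> t \<partial>N))"


section \<open>Reproducing kernel Hilbert space of a continuous centered Gaussian process\<close>

definition finite_borel_measure_on :: "real \<Rightarrow> real measure \<Rightarrow> bool" where
  "finite_borel_measure_on T \<nu> \<longleftrightarrow> finite_measure \<nu> \<and> sets \<nu> = sets (restrict_space borel {0..T})"

text \<open>The \<open>L\<^sup>2\<close>-closure of the integrals of the process against signed measures. A signed measure
  is a difference \<open>\<nu>1 - \<nu>2\<close> of finite Borel measures (Jordan decomposition). Elements are
  square-integrable functions rather than classes modulo almost sure equality.\<close>

definition gaussian_L2_space ::
  "'w measure \<Rightarrow> real \<Rightarrow> ('w \<Rightarrow> real \<Rightarrow> real) \<Rightarrow> ('w \<Rightarrow> real) set" where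
  "gaussian_L2_space N T U =
     {Y \<in> borel_measurable N.
        (\<integral>\<^sup>+\<omega>. ennreal ((Y \<omega>)\<^sup>2) \<partial>N) < \<infinity> \<and>
        (\<forall>\<epsilon>>0. \<exists>\<nu>1 \<nu>2. finite_borel_measure_on T \<nu>1 \<and> finite_borel_measure_on T \<nu>2 \<and>
           (\<integral>\<^sup>+\<omega>. ennreal ((Y \<omega> - ((\<integral>t. U \<omega> t \<partial>\<nu>1) - (\<integral>t. U \<omega> t \<partial>\<nu>2)))\<^sup>2) \<partial>N) < ennreal \<epsilon>)}"

definition rkhs_map ::
  "'w measure \<Rightarrow> real \<Rightarrow> ('w \<Rightarrow> real \<Rightarrow> real) \<Rightarrow> ('w \<Rightarrow> real) \<Rightarrow> real \<Rightarrow> real" where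
  "rkhs_map N T U Y = (\<lambda>t\<in>{0..T}. \<integral>\<omega>. U \<omega> t * Y \<omega> \<partial>N)"

definition rkhs :: "'w measure \<Rightarrow> real \<Rightarrow> ('w \<Rightarrow> real \<Rightarrow> real) \<Rightarrow> (real \<Rightarrow> real) set" where
  "rkhs N T U = rkhs_map N T U ` gaussian_L2_space N T U"

text \<open>The squared norm transported from \<open>L\<^sup>2\<close>: the preimage under \<open>rkhs_map\<close> is unique up to almost
  sure equality, so the choice of representative does not matter.\<close>

definition rkhs_norm_sq ::
  "'w measure \<Rightarrow> real \<Rightarrow> ('w \<Rightarrow> real \<Rightarrow> real) \<Rightarrow> (real \<Rightarrow> real) \<Rightarrow> ennreal" where
  "rkhs_norm_sq N T U h =
     (if h \<in> rkhs N T U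
      then ennreal (\<integral>\<omega>. ((SOME Y. Y \<in> gaussian_L2_space N T U \<and> rkhs_map N T U Y = h) \<omega>)\<^sup>2 \<partial>N)
      else \<infinity>)"

definition gaussian_rate ::
  "'w measure \<Rightarrow> real \<Rightarrow> ('w \<Rightarrow> real \<Rightarrow> real) \<Rightarrow> (real \<Rightarrow> real) \<Rightarrow> ennreal" where
  "gaussian_rate N T U h =
     (if h \<in> rkhs N T U then ennreal (1 / 2) * rkhs_norm_sq N T U h else \<infinity>)"

definition conditional_rate ::
  "'w measure \<Rightarrow> real \<Rightarrow> ('w \<Rightarrow> real \<Rightarrow> real) \<Rightarrow> (real \<Rightarrow> real) \<Rightarrow> real \<Rightarrow> (real \<Rightarrow> real) \<Rightarrow> ennreal" where
  "conditional_rate N T U z a b =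
     (if a > 0 then ennreal (1 / (2 * a\<^sup>2)) * rkhs_norm_sq N T U (\<lambda>t\<in>{0..T}. z t - b t)
      else if (\<forall>t\<in>{0..T}. z t - b t = 0) \<and> a = 0 then 0
      else \<infinity>)"

end

theory Submission
  imports Defs
begin

text \<open>
  Write \<open>E\<close> for the product of the half line, the path space (for \<open>b\<close>) and the path space (for \<open>x\<close>).
  The map sending \<open>((a, b), x)\<close> to \<open>((a, b), a x + b)\<close> is continuous on \<open>E\<close> and sends
  \<open>((A\<^sup>n, B\<^sup>n), X\<^sup>n)\<close> to \<open>((A\<^sup>n, B\<^sup>n), Z\<^sup>n)\<close>. So the theorem is an instance of the contraction
  principle (\<open>ldp_elements_contraction\<close>), applied to the large deviation principle for
  \<open>((A\<^sup>n, B\<^sup>n), X\<^sup>n)\<close>; a second contraction, along the projection to the last factor, gives the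
  statement on \<open>Z\<^sup>n\<close>.

  The principle for the pair holds because the two parts are independent and both rates are good;
  the rate is the sum (\<open>ldp_elements_Pair\<close>). Open boxes have product probability, which gives the
  lower bound at once. For the upper bound, a product of compact level sets is covered by finitely
  many open sets whose part in the given closed set has small probability; by Wallace's theorem their
  union contains a single box around the level sets, and the complement of that box is controlled by the two marginal upper bounds.
  The path space is separable (\<open>second_countable_path_top\<close>), so that Borel sets of a
  product are generated by boxes.

  It remains to compute the contracted rate (\<open>affine_image_rate\<close>). For \<open>a > 0\<close> the fibre over
  \<open>((a, b), z)\<close> is the single path \<open>x = (z - b) / a\<close>, and homogeneity of the squared Hilbert space
  norm produces the factor \<open>1 / a\<^sup>2\<close>. For \<open>a = 0\<close> the fibre is empty unless \<open>z = b\<close>, in which case it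
  contains \<open>x = 0\<close>, whose rate is \<open>0\<close>. Homogeneity and the value at \<open>0\<close> rest on the norm being well
  defined: two elements of the Gaussian Hilbert space with the same image have the same second
  moment. Indeed their difference is orthogonal to every \<open>U(t)\<close>, hence, by Fubini, to every integral
  of \<open>U\<close> against a finite measure, hence to the closure of these integrals and so to both elements
  (\<open>gaussian_L2_space_orthogonal\<close>). Fubini applies because the variances of a continuous Gaussian
  process are bounded on the whole interval (\<open>continuous_gaussian_process_bounded_variance\<close>).
\<close>

section \<open>Second countable topologies\<close>

text \<open>
  Balls with rational radii around the points of a countable dense set form a base.
\<close>

lemma second_countable_mtopology:
  assumes "Metric_space M d" "countable D" "D \<subseteq> M"
    and dense: "\<And>x e. x \<in> M \<Longrightarrow> e > 0 \<Longrightarrow> \<exists>y\<in>D. d x y < e"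
  shows "second_countable (Metric_space.mtopology M d)"
proof -
  interpret Metric_space M d by fact
  define \<B> where "\<B> = (\<lambda>(y, q). mball y (of_rat q)) ` (D \<times> (UNIV :: rat set))"
  have "\<exists>V\<in>\<B>. x \<in> V \<and> V \<subseteq> S" if S: "openin mtopology S" "x \<in> S" for S x
  proof -
    have xM: "x \<in> M"
      using S openin_subset by fastforce
    obtain r where r: "r > 0" "mball x r \<subseteq> S"
      using S unfolding openin_mtopology by blast
    obtain q where q: "0 < real_of_rat q" "real_of_rat q < r / 2"
      using of_rat_dense[of 0 "r/2"] r by auto
    obtain y where y: "y \<in> D" "d x y < of_rat q"
      using dense[OF xM q(1)] by blast
    have yM: "y \<in> M" using y assms by auto
    have "mball y (of_rat q) \<subseteq> mball x r"
    proof
      fix z assume "z \<in> mball y (of_rat q)"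
      then have z: "z \<in> M" "d y z < of_rat q" by auto
      have "d x z \<le> d x y + d y z" using triangle xM yM z by blast
      with y z q xM show "z \<in> mball x r" by auto
    qed
    moreover have "x \<in> mball y (of_rat q)"
      using y xM yM by (simp add: commute)
    moreover have "mball y (of_rat q) \<in> \<B>" using y by (force simp: \<B>_def)
    ultimately show ?thesis using r by blast
  qed
  moreover have "countable \<B>" using assms by (simp add: \<B>_def)
  moreover have "\<forall>V\<in>\<B>. openin mtopology V" by (auto simp: \<B>_def)
  ultimately show ?thesis unfolding second_countable_def by blast
qed

lemma second_countable_prod_topology:
  assumes "second_countable X" "second_countable Y"
  shows "second_countable (prod_topology X Y)"
proof -
  obtain A where A: "countable A" "\<And>V. V \<in> A \<Longrightarrow> openin X V"
    "\<And>U x. openin X U \<Longrightarrow> x \<in> U \<Longrightarrow> \<exists>V\<in>A. x \<in> V \<and> V \<subseteq> U"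
    using assms(1) unfolding second_countable_def by metis
  obtain B where B: "countable B" "\<And>V. V \<in> B \<Longrightarrow> openin Y V"
    "\<And>U x. openin Y U \<Longrightarrow> x \<in> U \<Longrightarrow> \<exists>V\<in>B. x \<in> V \<and> V \<subseteq> U"
    using assms(2) unfolding second_countable_def by metis
  define C where "C = (\<lambda>p. fst p \<times> snd p) ` (A \<times> B)"
  have "\<exists>W\<in>C. z \<in> W \<and> W \<subseteq> S" if S: "openin (prod_topology X Y) S" "z \<in> S" for S z
  proof -
    obtain x y where z: "z = (x, y)" by (cases z)
    obtain U V where "openin X U" "openin Y V" "x \<in> U" "y \<in> V" "U \<times> V \<subseteq> S"
      using S unfolding z openin_prod_topology_alt by metis
    with A(3)[of U x] B(3)[of V y] obtain U' V' where
      UV: "U' \<in> A" "V' \<in> B" "x \<in> U'" "y \<in> V'" "U' \<times> V' \<subseteq> S" by blast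
    from UV(1,2) have "U' \<times> V' \<in> C"
      unfolding C_def by (intro image_eqI[of _ _ "(U', V')"]) simp_all
    moreover have "z \<in> U' \<times> V'" using UV(3,4) by (simp add: z)
    ultimately show ?thesis using UV(5) by (intro bexI[of _ "U' \<times> V'"] conjI)
  qed
  moreover have "countable C" unfolding C_def by (intro countable_image countable_SIGMA A(1) B(1))
  moreover have "openin (prod_topology X Y) W" if "W \<in> C" for W
    using that A(2) B(2) by (auto simp: openin_prod_Times_iff C_def)
  ultimately show ?thesis unfolding second_countable_def by blast
qed

lemma second_countable_euclidean: "second_countable (euclidean :: 'a::second_countable_topology topology)"
proof -
  obtain B :: "'a set set" where B: "countable B" "topological_basis B"
    using ex_countable_basis by blast
  show ?thesis
    unfolding second_countable_def
  proof (intro exI conjI ballI allI impI)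
    show "countable B" by fact
    show "openin euclidean V" if "V \<in> B" for V
      using topological_basis_open[OF B(2) that] by simp
    show "\<exists>V\<in>B. x \<in> V \<and> V \<subseteq> U" if "openin euclidean U \<and> x \<in> U" for U and x :: 'a
      using topological_basisE[OF B(2), of U x] that by auto
  qed
qed

section \<open>Borel sets of an abstract topology\<close>

lemma space_borel_of [simp]: "space (borel_of X) = topspace X"
  by (simp add: borel_of_def space_measure_of_conv)

lemma sets_borel_of: "sets (borel_of X) = sigma_sets (topspace X) {S. openin X S}"
  unfolding borel_of_def by (rule sets_measure_of) (auto dest: openin_subset)

lemma openin_borel_of: "openin X S \<Longrightarrow> S \<in> sets (borel_of X)"
  by (simp add: sets_borel_of)

lemma closedin_borel_of: "closedin X S \<Longrightarrow> S \<in> sets (borel_of X)"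
  by (metis closedin_def openin_borel_of sets.compl_sets space_borel_of double_diff order_refl)

lemma measurable_borel_ofI:
  assumes "\<And>w. w \<in> space M \<Longrightarrow> f w \<in> topspace X"
    and "\<And>S. openin X S \<Longrightarrow> f -` S \<inter> space M \<in> sets M"
  shows "f \<in> measurable M (borel_of X)"
  unfolding borel_of_def
proof (rule measurable_measure_of)
  show "{S. openin X S} \<subseteq> Pow (topspace X)" using openin_subset by blast
qed (use assms in auto)

lemma continuous_map_measurable_borel_of:
  assumes "continuous_map X Y f"
  shows "f \<in> measurable (borel_of X) (borel_of Y)"
proof (rule measurable_borel_ofI)
  show "f w \<in> topspace Y" if "w \<in> space (borel_of X)" for w
    using assms that by (auto simp: continuous_map_def)
  show "f -` S \<inter> space (borel_of X) \<in> sets (borel_of X)" if "openin Y S" for S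
  proof -
    have "f -` S \<inter> space (borel_of X) = {x \<in> topspace X. f x \<in> S}" by auto
    then show ?thesis using openin_continuous_map_preimage[OF assms that] openin_borel_of by metis
  qed
qed

text \<open>
  Every open set of the product is a union of countably many base boxes, so it suffices to pull back boxes.
  Second countability is essential: in general the Borel sets of a product are not generated by boxes.
\<close>

lemma measurable_Pair_borel_of:
  assumes F: "F \<in> measurable M (borel_of X)" and G: "G \<in> measurable M (borel_of Y)"
    and sc: "second_countable X" "second_countable Y"
  shows "(\<lambda>w. (F w, G w)) \<in> measurable M (borel_of (prod_topology X Y))"
proof (rule measurable_borel_ofI)
  show "(F w, G w) \<in> topspace (prod_topology X Y)" if "w \<in> space M" for w
    using measurable_space[OF F that] measurable_space[OF G that] by simp
  fix S assume S: "openin (prod_topology X Y) S"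
  obtain A where A: "countable A" "\<And>V. V \<in> A \<Longrightarrow> openin X V"
    "\<And>U x. openin X U \<Longrightarrow> x \<in> U \<Longrightarrow> \<exists>V\<in>A. x \<in> V \<and> V \<subseteq> U"
    using sc(1) unfolding second_countable_def by metis
  obtain B where B: "countable B" "\<And>V. V \<in> B \<Longrightarrow> openin Y V"
    "\<And>U x. openin Y U \<Longrightarrow> x \<in> U \<Longrightarrow> \<exists>V\<in>B. x \<in> V \<and> V \<subseteq> U"
    using sc(2) unfolding second_countable_def by metis
  define C where "C = {p \<in> A \<times> B. fst p \<times> snd p \<subseteq> S}"
  have "S = (\<Union>(U, V)\<in>C. U \<times> V)"
  proof
    show "S \<subseteq> (\<Union>(U, V)\<in>C. U \<times> V)"
    proof
      fix z assume z: "z \<in> S"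
      obtain x y where xy: "z = (x, y)" by (cases z)
      obtain U V where "openin X U" "openin Y V" "x \<in> U" "y \<in> V" "U \<times> V \<subseteq> S"
        using S z unfolding xy openin_prod_topology_alt by metis
      with A(3)[of U x] B(3)[of V y] obtain U' V' where
        "U' \<in> A" "V' \<in> B" "x \<in> U'" "y \<in> V'" "U' \<times> V' \<subseteq> S" by blast
      then have "(U', V') \<in> C" "z \<in> U' \<times> V'" by (auto simp: C_def xy)
      then show "z \<in> (\<Union>(U, V)\<in>C. U \<times> V)" by blast
    qed
  qed (auto simp: C_def)
  then have "(\<lambda>w. (F w, G w)) -` S \<inter> space M
      = (\<Union>(U, V)\<in>C. (F -` U \<inter> space M) \<inter> (G -` V \<inter> space M))" by blast
  also have "\<dots> \<in> sets M"
  proof (rule sets.countable_UN'')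
    show "countable C" unfolding C_def using A(1) B(1) by (auto intro: countable_Collect)
    show "(case p of (U, V) \<Rightarrow> (F -` U \<inter> space M) \<inter> (G -` V \<inter> space M)) \<in> sets M"
      if "p \<in> C" for p
      using that A(2) B(2) measurable_sets[OF F openin_borel_of] measurable_sets[OF G openin_borel_of]
      by (clarsimp simp: C_def)
  qed
  finally show "(\<lambda>w. (F w, G w)) -` S \<inter> space M \<in> sets M" .
qed

section \<open>The space of continuous paths\<close>

lemma topspace_path_top:
  "topspace (path_top T) = {f. continuous_on {0..T} f \<and> f \<in> extensional {0..T}}"
proof -
  have "continuous_on {0..T} f \<Longrightarrow> Metric_space.mbounded UNIV dist (f ` {0..T})" for f :: "real \<Rightarrow> 'a"
    using compact_imp_bounded[OF compact_continuous_image[of "{0..T}" f]] by (simp add: mbounded_iff_bounded)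
  then show ?thesis
    by (auto simp: path_top_def topspace_mtopology_of continuous_map_iff_continuous)
qed

lemma restrict_in_path_top:
  assumes "continuous_on {0..T} f"
  shows "restrict f {0..T} \<in> topspace (path_top T)"
proof -
  have "continuous_on {0..T} (restrict f {0..T})"
    using assms by (subst continuous_on_cong[OF refl, of _ _ f]) (simp_all only: restrict_apply' if_True)
  then show ?thesis by (simp add: topspace_path_top)
qed

abbreviation path_dist :: "real \<Rightarrow> (real \<Rightarrow> 'b::euclidean_space) \<Rightarrow> (real \<Rightarrow> 'b) \<Rightarrow> real" where
  "path_dist T \<equiv> mdist (cfunspace (top_of_set {0..T}) euclidean_metric)"

lemma Metric_space_path: "Metric_space (topspace (path_top T)) (path_dist T)"
  unfolding path_top_def topspace_mtopology_of by (rule Metric_space_mspace_mdist)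

text \<open>
  Together with the preceding lemma, this allows the sup-distance to be used with \<open>topspace (path_top
  T)\<close> as carrier, without mentioning the boundedness that is built into the function space metric.
\<close>

lemma mtopology_path: "Metric_space.mtopology (topspace (path_top T)) (path_dist T) = path_top T"
  unfolding path_top_def topspace_mtopology_of by (simp only: mtopology_of_def)

lemma path_dist_le:
  "0 \<le> r \<Longrightarrow> (\<And>t. t \<in> {0..T} \<Longrightarrow> dist (f t) (g t) \<le> r) \<Longrightarrow> path_dist T f g \<le> r"
  using mdist_cfunspace_le[of r "top_of_set {0..T}" euclidean_metric f g] by simp

lemma dist_le_path_dist:
  assumes "f \<in> topspace (path_top T)" "g \<in> topspace (path_top T)" "t \<in> {0..T}"
  shows "dist (f t) (g t) \<le> path_dist T f g"
  using mdist_cfunspace_imp_mdist_le[of f "top_of_set {0..T}" euclidean_metric g "path_dist T f g" t] assms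
  by (simp add: path_top_def topspace_mtopology_of)

lemma metrizable_path_top: "metrizable_space (path_top T)"
  using Metric_space.metrizable_space_mtopology[OF Metric_space_path] by (simp add: mtopology_path)

text \<open>
  Polynomials with rational coefficients in each coordinate are dense: Weierstrass approximates a path by real
  polynomials, and their finitely many coefficients are then perturbed. A countable family of polynomials is
  indexed by one list of rationals per coordinate.
\<close>

lemma second_countable_path_top: "second_countable (path_top T :: (real \<Rightarrow> real ^ 'p) topology)"
proof -
  define P :: "('p \<Rightarrow> rat list) \<Rightarrow> real \<Rightarrow> real ^ 'p" where
    "P c = (\<lambda>t\<in>{0..T}. \<chi> i. \<Sum>j<length (c i). of_rat (c i ! j) * t ^ j)" for c
  have "\<exists>y\<in>range P. path_dist T f y < e"
    if f: "f \<in> topspace (path_top T)" and e: "e > 0" for f e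
  proof -
    define m where "m = real CARD('p)"
    have m: "m > 0" by (simp add: m_def)
    have cont: "continuous_on {0..T} (\<lambda>t. f t $ i)" for i
      using f by (auto simp: topspace_path_top intro!: continuous_intros)
    define K where "K = max 1 T"
    have "\<exists>q. \<forall>t\<in>{0..T}. \<bar>f t $ i - (\<Sum>j<length q. real_of_rat (q ! j) * t ^ j)\<bar> \<le> e / (2 * m)" for i
    proof -
      have e4: "e / (4 * m) > 0" using e m by simp
      obtain g where g: "polynomial_function g" "\<And>t. t \<in> {0..T} \<Longrightarrow> norm (f t $ i - g t) < e / (4 * m)"
        using Stone_Weierstrass_polynomial_function[OF compact_Icc cont[of i] e4] by blast
      have "real_polynomial_function g" using g by (simp add: real_polynomial_function_eq)
      then obtain a n where a: "g = (\<lambda>x. \<Sum>j\<le>n. a j * x ^ j)"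
        unfolding real_polynomial_function_iff_sum by blast
      \<comment> \<open>A perturbation of the \<open>n + 1\<close> coefficients by \<open>\<delta>\<close> moves the polynomial by at most \<open>e / (4 * m)\<close>, since \<open>\<bar>t ^ j\<bar> \<le> K ^ n\<close>.\<close>
      define \<delta> where "\<delta> = e / (4 * m * (n + 1) * K ^ n)"
      have \<delta>: "\<delta> > 0" using e m by (simp add: \<delta>_def K_def)
      have "\<exists>q. \<bar>a j - real_of_rat q\<bar> < \<delta>" for j
        using of_rat_dense[of "a j - \<delta>" "a j + \<delta>"] \<delta> by (auto simp: abs_less_iff) (smt (verit))
      then obtain q where q: "\<And>j. \<bar>a j - real_of_rat (q j)\<bar> < \<delta>" by metis
      define l where "l = map q [0..<Suc n]"
      have "\<bar>f t $ i - (\<Sum>j<length l. real_of_rat (l ! j) * t ^ j)\<bar> \<le> e / (2 * m)" if t: "t \<in> {0..T}" for t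
      proof -
        have tj: "\<bar>t ^ j\<bar> \<le> K ^ n" if "j \<le> n" for j
        proof -
          have "\<bar>t ^ j\<bar> \<le> K ^ j" using t by (auto simp: power_abs K_def intro!: power_mono)
          also have "\<dots> \<le> K ^ n" using that by (intro power_increasing) (auto simp: K_def)
          finally show ?thesis .
        qed
        have eq: "(\<Sum>j<length l. real_of_rat (l ! j) * t ^ j) = (\<Sum>j\<le>n. real_of_rat (q j) * t ^ j)"
          by (rule sum.cong) (auto simp: l_def lessThan_Suc_atMost simp del: upt_Suc)
        have "\<bar>g t - (\<Sum>j\<le>n. real_of_rat (q j) * t ^ j)\<bar> = \<bar>\<Sum>j\<le>n. (a j - real_of_rat (q j)) * t ^ j\<bar>"
          by (simp add: a sum_subtractf algebra_simps)
        also have "\<dots> \<le> (\<Sum>j\<le>n. \<bar>(a j - real_of_rat (q j)) * t ^ j\<bar>)" by (rule sum_abs)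
        also have "\<dots> \<le> (\<Sum>j\<le>n. \<delta> * K ^ n)"
          unfolding abs_mult using q tj \<delta> by (intro sum_mono mult_mono) (auto intro: less_imp_le)
        also have "\<dots> = e / (4 * m)" using m by (simp add: \<delta>_def K_def add.commute)
        finally have "\<bar>g t - (\<Sum>j\<le>n. real_of_rat (q j) * t ^ j)\<bar> \<le> e / (4 * m)" .
        moreover have "\<bar>f t $ i - g t\<bar> < e / (4 * m)" using g(2)[OF t] by simp
        moreover have "e / (4 * m) + e / (4 * m) = e / (2 * m)" using m by (simp add: field_simps)
        ultimately show ?thesis unfolding eq by linarith
      qed
      then show ?thesis by blast
    qed
    then obtain c where c: "\<And>i t. t \<in> {0..T} \<Longrightarrow>
        \<bar>f t $ i - (\<Sum>j<length (c i). real_of_rat (c i ! j) * t ^ j)\<bar> \<le> e / (2 * m)" by metis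
    have "path_dist T f (P c) \<le> e / 2"
    proof (rule path_dist_le)
      fix t assume t: "t \<in> {0..T}"
      have "dist (f t) (P c t) \<le> (\<Sum>i\<in>UNIV. \<bar>(f t - P c t) $ i\<bar>)"
        unfolding dist_norm by (rule norm_le_l1_cart)
      also have "\<dots> \<le> (\<Sum>i\<in>(UNIV::'p set). e / (2 * m))"
        using c[OF t] t by (intro sum_mono) (auto simp: P_def)
      also have "\<dots> = e / 2" by (simp add: m_def)
      finally show "dist (f t) (P c t) \<le> e / 2" .
    qed (use e in simp)
    then have "path_dist T f (P c) < e" using e by linarith
    then show ?thesis by blast
  qed
  moreover have "range P \<subseteq> topspace (path_top T)"
    unfolding P_def by (intro image_subsetI restrict_in_path_top continuous_intros)
  ultimately have "second_countable (Metric_space.mtopology (topspace (path_top T)) (path_dist T) :: (real \<Rightarrow> real ^ 'p) topology)"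
    by (intro second_countable_mtopology[OF Metric_space_path, of "range P"]) auto
  then show ?thesis by (simp add: mtopology_path)
qed

lemma second_countable_scale_path_top:
  "second_countable (scale_path_top T :: (real \<times> (real \<Rightarrow> real ^ 'p)) topology)"
  unfolding scale_path_top_def
  by (rule second_countable_prod_topology[OF second_countable_subtopology[OF second_countable_euclidean]
        second_countable_path_top])

lemma metrizable_scale_path_top: "metrizable_space (scale_path_top T)"
  unfolding scale_path_top_def
  by (intro metrizable_space_prod_topology[THEN iffD2] disjI2 conjI
      metrizable_space_subtopology[OF metrizable_space_euclidean] metrizable_path_top)

text \<open>
  Near \<open>((a, b), x)\<close> the change is \<open>(a - a') x + a' (x - x') + (b - b')\<close>, where
  \<open>x\<close> is bounded on the compact interval and \<open>a'\<close> stays below \<open>a + 1\<close>.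
\<close>

lemma continuous_map_affine_path:
  "continuous_map (prod_topology (scale_path_top T) (path_top T)) (path_top T :: (real \<Rightarrow> real ^ 'p) topology)
     (\<lambda>((a, b), x). (\<lambda>t\<in>{0..T}. a *\<^sub>R x t + b t))"
  (is "continuous_map ?X _ ?f")
proof -
  define mb where "mb = Metric_space.mball (topspace (path_top T) :: (real \<Rightarrow> real ^ 'p) set) (path_dist T)"
  have in_mb: "g \<in> mb f r \<longleftrightarrow> f \<in> topspace (path_top T) \<and> g \<in> topspace (path_top T) \<and> path_dist T f g < r" for f g r
    unfolding mb_def by (rule Metric_space.in_mball[OF Metric_space_path])
  have open_mb: "openin (path_top T) (mb f r)" for f r
    unfolding mb_def using Metric_space.openin_mball[OF Metric_space_path] by (simp only: mtopology_path)
  have mb0: "f \<in> mb f r" if "f \<in> topspace (path_top T)" "r > 0" for f r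
    unfolding mb_def using that Metric_space.centre_in_mball_iff[OF Metric_space_path] by blast
  have ran: "?f p \<in> topspace (path_top T)" if "p \<in> topspace ?X" for p
  proof -
    obtain a b x where abx: "p = ((a, b), x)" by (cases p, cases "fst p") auto
    show ?thesis
      using that unfolding abx prod.case
      by (intro restrict_in_path_top continuous_intros) (simp_all add: scale_path_top_def topspace_path_top)
  qed
  have "\<exists>S. openin ?X S \<and> p \<in> S \<and> (\<forall>q\<in>S. ?f q \<in> mb (?f p) e)"
    if p: "p \<in> topspace ?X" and e: "e > 0" for p e
  proof -
    obtain a b x where abx: "p = ((a, b), x)" by (cases p, cases "fst p") auto
    from p have a: "a \<ge> 0" and b: "b \<in> topspace (path_top T)" and x: "x \<in> topspace (path_top T)"
      by (auto simp: abx scale_path_top_def)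
    have "bounded (x ` {0..T})"
      using x by (auto simp: topspace_path_top intro!: compact_imp_bounded compact_continuous_image)
    then obtain K where K: "K > 0" "\<And>t. t \<in> {0..T} \<Longrightarrow> norm (x t) \<le> K"
      by (auto simp: bounded_pos)
    define \<delta> where "\<delta> = min 1 (e / (2 * (a + K + 2)))"
    have \<delta>: "\<delta> > 0" "\<delta> \<le> 1" "(a + K + 2) * \<delta> \<le> e / 2"
    proof -
      show "\<delta> > 0" "\<delta> \<le> 1" using e a K by (auto simp: \<delta>_def)
      have "\<delta> \<le> e / (2 * (a + K + 2))" by (simp add: \<delta>_def)
      then have "(a + K + 2) * \<delta> \<le> (a + K + 2) * (e / (2 * (a + K + 2)))"
        using a K by (intro mult_left_mono) auto
      also have "\<dots> = e / 2" using a K by (simp add: field_simps)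
      finally show "(a + K + 2) * \<delta> \<le> e / 2" .
    qed
    define S where "S = (({0..} \<inter> ball a \<delta>) \<times> mb b \<delta>) \<times> mb x \<delta>"
    have "openin ?X S"
      unfolding S_def scale_path_top_def openin_prod_Times_iff
      by (intro disjI2 conjI open_mb openin_open_Int open_ball)
    moreover have "p \<in> S" using a b x \<delta> mb0 by (simp add: S_def abx)
    moreover have "?f q \<in> mb (?f p) e" if q: "q \<in> S" for q
    proof -
      obtain a' b' x' where q': "q = ((a', b'), x')" by (cases q, cases "fst q") auto
      from q have a': "a' \<ge> 0" "dist a a' < \<delta>" and b': "b' \<in> topspace (path_top T)" "path_dist T b b' < \<delta>"
        and x': "x' \<in> topspace (path_top T)" "path_dist T x x' < \<delta>"
        by (auto simp: q' S_def in_mb)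
      have "path_dist T (?f p) (?f q) \<le> e / 2"
      proof (rule path_dist_le)
        fix t assume t: "t \<in> {0..T}"
        have 1: "norm (b t - b' t) \<le> \<delta>" "norm (x t - x' t) \<le> \<delta>"
          using dist_le_path_dist[OF b b'(1) t] dist_le_path_dist[OF x x'(1) t] b' x'
          by (auto simp: dist_norm)
        have "dist (?f p t) (?f q t) = norm ((a - a') *\<^sub>R x t + a' *\<^sub>R (x t - x' t) + (b t - b' t))"
          using t by (simp add: abx q' dist_norm algebra_simps)
        also have "\<dots> \<le> \<bar>a - a'\<bar> * norm (x t) + a' * norm (x t - x' t) + norm (b t - b' t)"
          by (intro norm_triangle_le add_mono) (use a' in auto)
        also have "\<dots> \<le> \<delta> * K + (a + 1) * \<delta> + \<delta>"
          using 1 K(2)[OF t] a' \<delta> a by (intro add_mono mult_mono) (auto simp: dist_real_def)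
        also have "\<dots> \<le> e / 2" using \<delta>(3) by (simp add: algebra_simps)
        finally show "dist (?f p t) (?f q t) \<le> e / 2" .
      qed (use e in simp)
      moreover have "q \<in> topspace ?X" using a' b' x' by (simp add: q' scale_path_top_def)
      ultimately show ?thesis using ran p e unfolding in_mb by simp
    qed
    ultimately show ?thesis by blast
  qed
  then have "continuous_map ?X (Metric_space.mtopology (topspace (path_top T)) (path_dist T)) ?f"
    unfolding Metric_space.continuous_map_to_metric[OF Metric_space_path] mb_def by blast
  then show ?thesis by (simp only: mtopology_path)
qed

section \<open>Large deviation bounds as eventual exponential bounds\<close>

lemma scaled_ext_ln_le_iff:
  fixes g p c :: real
  assumes "g > 0" "p \<ge> 0"
  shows "ereal (1 / g) * ext_ln p \<le> ereal (- c) \<longleftrightarrow> p \<le> exp (- (g * c))"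
proof (cases "p = 0")
  case True
  then show ?thesis using assms by (simp add: ext_ln_def)
next
  case False
  then have "ln p / g \<le> - c \<longleftrightarrow> p \<le> exp (- (g * c))"
    using assms exp_le_cancel_iff[of "ln p" "- (g * c)"] by (simp add: pos_divide_le_eq mult.commute)
  with False show ?thesis by (simp add: ext_ln_def)
qed

lemma le_scaled_ext_ln_iff:
  fixes g p c :: real
  assumes "g > 0" "p \<ge> 0"
  shows "ereal (- c) \<le> ereal (1 / g) * ext_ln p \<longleftrightarrow> exp (- (g * c)) \<le> p"
proof (cases "p = 0")
  case True
  then show ?thesis using assms by (simp add: ext_ln_def)
next
  case False
  then have "- c \<le> ln p / g \<longleftrightarrow> exp (- (g * c)) \<le> p"
    using assms exp_le_cancel_iff[of "- (g * c)" "ln p"] by (simp add: pos_le_divide_eq mult.commute)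
  with False show ?thesis by (simp add: ext_ln_def)
qed

lemma less_enn2ereal_iff: "0 \<le> c \<Longrightarrow> ereal c < enn2ereal J \<longleftrightarrow> ennreal c < J"
  by (simp add: less_ennreal.rep_eq enn2ereal_ennreal)

lemma enn2ereal_less_iff: "0 \<le> c \<Longrightarrow> enn2ereal J < ereal c \<longleftrightarrow> J < ennreal c"
  by (simp add: less_ennreal.rep_eq enn2ereal_ennreal)

text \<open>
  The extended logarithms are traded for real exponentials here once and for all: below, all asymptotic
  estimates are inequalities between probabilities and \<open>exp (- (\<gamma> n * c))\<close> that hold
  eventually. Strict inequality between \<open>c\<close> and the rate absorbs the slack of the upper limit.
\<close>

lemma limsup_scaled_ext_ln_le_iff:
  fixes \<gamma> p :: "nat \<Rightarrow> real"
  assumes \<gamma>: "\<And>n. \<gamma> n > 0" and p: "\<And>n. 0 \<le> p n" "\<And>n. p n \<le> 1"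
  shows "limsup (\<lambda>n. ereal (1 / \<gamma> n) * ext_ln (p n)) \<le> - enn2ereal J \<longleftrightarrow>
    (\<forall>c\<ge>0. ennreal c < J \<longrightarrow> (\<forall>\<^sub>F n in sequentially. p n \<le> exp (- (\<gamma> n * c))))"
    (is "limsup ?L \<le> _ \<longleftrightarrow> ?R")
proof
  assume L: "limsup ?L \<le> - enn2ereal J"
  show ?R
  proof (intro allI impI)
    fix c :: real assume c: "c \<ge> 0" "ennreal c < J"
    then have "- enn2ereal J < ereal (- c)"
      using less_enn2ereal_iff[of c J] by (metis ereal_minus_less_minus uminus_ereal.simps(1))
    then have "\<forall>\<^sub>F n in sequentially. ?L n < ereal (- c)"
      using L unfolding Limsup_le_iff by blast
    then show "\<forall>\<^sub>F n in sequentially. p n \<le> exp (- (\<gamma> n * c))"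
      by eventually_elim (metis \<gamma> p(1) less_imp_le scaled_ext_ln_le_iff)
  qed
next
  assume R: ?R
  show "limsup ?L \<le> - enn2ereal J"
    unfolding Limsup_le_iff
  proof (intro allI impI)
    fix y assume "- enn2ereal J < y"
    then have "- y < enn2ereal J" by (metis ereal_minus_less_minus ereal_uminus_uminus)
    then obtain c where c: "- y < ereal c" "ereal c < enn2ereal J" using ereal_dense2 by blast
    have y: "ereal (- c) < y" using c(1) by (metis ereal_minus_less_minus ereal_uminus_uminus uminus_ereal.simps(1))
    \<comment> \<open>For negative \<open>c\<close> the bound exceeds 1 and is trivial.\<close>
    have "\<forall>\<^sub>F n in sequentially. p n \<le> exp (- (\<gamma> n * c))"
    proof (cases "c \<ge> 0")
      case True
      then show ?thesis using R c(2) less_enn2ereal_iff by blast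
    next
      case False
      have "p n \<le> exp (- (\<gamma> n * c))" for n
      proof -
        have "\<gamma> n * c \<le> 0" using \<gamma>[of n] False by (simp add: mult_nonneg_nonpos)
        then show ?thesis using p(2)[of n] by (meson one_le_exp_iff neg_0_le_iff_le order_trans)
      qed
      then show ?thesis by simp
    qed
    then show "\<forall>\<^sub>F n in sequentially. ?L n < y"
      by eventually_elim (metis \<gamma> p(1) le_less_trans y scaled_ext_ln_le_iff)
  qed
qed

lemma le_liminf_scaled_ext_ln_iff:
  fixes \<gamma> p :: "nat \<Rightarrow> real"
  assumes \<gamma>: "\<And>n. \<gamma> n > 0" and p: "\<And>n. 0 \<le> p n"
  shows "- enn2ereal J \<le> liminf (\<lambda>n. ereal (1 / \<gamma> n) * ext_ln (p n)) \<longleftrightarrow>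
    (\<forall>c\<ge>0. J < ennreal c \<longrightarrow> (\<forall>\<^sub>F n in sequentially. exp (- (\<gamma> n * c)) \<le> p n))"
    (is "_ \<le> liminf ?L \<longleftrightarrow> ?R")
proof
  assume L: "- enn2ereal J \<le> liminf ?L"
  show ?R
  proof (intro allI impI)
    fix c :: real assume c: "c \<ge> 0" "J < ennreal c"
    then have "ereal (- c) < - enn2ereal J"
      using enn2ereal_less_iff[of c J] by (metis ereal_minus_less_minus uminus_ereal.simps(1))
    then have "\<forall>\<^sub>F n in sequentially. ereal (- c) < ?L n"
      using L unfolding le_Liminf_iff by blast
    then show "\<forall>\<^sub>F n in sequentially. exp (- (\<gamma> n * c)) \<le> p n"
      by eventually_elim (metis \<gamma> p less_imp_le le_scaled_ext_ln_iff)
  qed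
next
  assume R: ?R
  show "- enn2ereal J \<le> liminf ?L"
    unfolding le_Liminf_iff
  proof (intro allI impI)
    fix y assume "y < - enn2ereal J"
    then have "enn2ereal J < - y" by (metis ereal_minus_less_minus ereal_uminus_uminus)
    then obtain c where c: "ereal c < - y" "enn2ereal J < ereal c" using ereal_dense2 by blast
    have y: "y < ereal (- c)" using c(1) by (metis ereal_minus_less_minus ereal_uminus_uminus uminus_ereal.simps(1))
    have c0: "c \<ge> 0" using c(2) enn2ereal_nonneg[of J] by (metis ereal_less_eq(5) less_imp_le order_trans)
    then have "\<forall>\<^sub>F n in sequentially. exp (- (\<gamma> n * c)) \<le> p n"
      using R c(2) enn2ereal_less_iff by blast
    then show "\<forall>\<^sub>F n in sequentially. y < ?L n"
      by eventually_elim (metis \<gamma> p less_le_trans y le_scaled_ext_ln_iff)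
  qed
qed

text \<open>
  Because an infimum lies below \<open>c\<close> exactly if some value does, the lower bound may be stated at
  single points of the open set.
\<close>

lemma ldp_iff:
  "ldp X \<gamma> \<mu> I \<longleftrightarrow>
     (\<forall>n. \<gamma> n > 0) \<and> filterlim \<gamma> at_top sequentially \<and>
     (\<forall>n. prob_space (\<mu> n) \<and> sets (\<mu> n) = sets (borel_of X)) \<and>
     rate_function X I \<and>
     (\<forall>\<Theta> x c. openin X \<Theta> \<longrightarrow> x \<in> \<Theta> \<longrightarrow> 0 \<le> c \<longrightarrow> I x < ennreal c \<longrightarrow>
        (\<forall>\<^sub>F n in sequentially. exp (- (\<gamma> n * c)) \<le> measure (\<mu> n) \<Theta>)) \<and>
     (\<forall>\<Gamma> c. closedin X \<Gamma> \<longrightarrow> 0 \<le> c \<longrightarrow> ennreal c < (INF x\<in>\<Gamma>. I x) \<longrightarrow>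
        (\<forall>\<^sub>F n in sequentially. measure (\<mu> n) \<Gamma> \<le> exp (- (\<gamma> n * c))))"
proof (cases "(\<forall>n. \<gamma> n > 0) \<and> (\<forall>n. prob_space (\<mu> n))")
  case True
  then have \<gamma>: "\<And>n. \<gamma> n > 0" and p: "\<And>n S. measure (\<mu> n) S \<le> 1"
    by (auto intro: prob_space.prob_le_1)
  show ?thesis
    unfolding ldp_def le_liminf_scaled_ext_ln_iff[OF \<gamma> measure_nonneg]
      limsup_scaled_ext_ln_le_iff[OF \<gamma> measure_nonneg p] INF_less_iff by (intro arg_cong2[of _ _ _ _ "(\<and>)"] refl) blast+
qed (auto simp: ldp_def)

lemma ldp_elements_iff:
  assumes M: "prob_space M"
  shows "ldp_elements M X \<gamma> Y I \<longleftrightarrow>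
     (\<forall>n. Y n \<in> measurable M (borel_of X)) \<and>
     (\<forall>n. \<gamma> n > 0) \<and> filterlim \<gamma> at_top sequentially \<and> rate_function X I \<and>
     (\<forall>\<Theta> x c. openin X \<Theta> \<longrightarrow> x \<in> \<Theta> \<longrightarrow> 0 \<le> c \<longrightarrow> I x < ennreal c \<longrightarrow>
        (\<forall>\<^sub>F n in sequentially. exp (- (\<gamma> n * c)) \<le> measure M (Y n -` \<Theta> \<inter> space M))) \<and>
     (\<forall>\<Gamma> c. closedin X \<Gamma> \<longrightarrow> 0 \<le> c \<longrightarrow> ennreal c < (INF x\<in>\<Gamma>. I x) \<longrightarrow>
        (\<forall>\<^sub>F n in sequentially. measure M (Y n -` \<Gamma> \<inter> space M) \<le> exp (- (\<gamma> n * c))))"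
proof (cases "\<forall>n. Y n \<in> measurable M (borel_of X)")
  case True
  then have Y: "\<And>n. Y n \<in> measurable M (borel_of X)" by blast
  have prob: "prob_space (distr M (borel_of X) (Y n))" for n
    by (rule prob_space.prob_space_distr[OF M Y])
  have eq: "measure (distr M (borel_of X) (Y n)) S = measure M (Y n -` S \<inter> space M)"
    if "openin X S \<or> closedin X S" for n S
    using that by (intro measure_distr Y) (auto simp: openin_borel_of closedin_borel_of)
  show ?thesis
    unfolding ldp_elements_def ldp_iff by (simp add: eq Y prob cong: imp_cong)
next
  case False
  then show ?thesis unfolding ldp_elements_def by (simp only: simp_thms)
qed

lemma ldp_elementsD:
  assumes "prob_space M" "ldp_elements M X \<gamma> Y I"
  shows "Y n \<in> measurable M (borel_of X)" "\<gamma> n > 0" "filterlim \<gamma> at_top sequentially"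
    "rate_function X I"
  using assms by (simp_all add: ldp_elements_iff)

lemma ldp_elements_lower:
  assumes "prob_space M" "ldp_elements M X \<gamma> Y I"
    and "openin X \<Theta>" "x \<in> \<Theta>" "0 \<le> c" "I x < ennreal c"
  shows "\<forall>\<^sub>F n in sequentially. exp (- (\<gamma> n * c)) \<le> measure M (Y n -` \<Theta> \<inter> space M)"
  using assms(2) unfolding ldp_elements_iff[OF assms(1)] using assms(3-) by blast

lemma ldp_elements_upper:
  assumes "prob_space M" "ldp_elements M X \<gamma> Y I"
    and "closedin X \<Gamma>" "0 \<le> c" "ennreal c < (INF x\<in>\<Gamma>. I x)"
  shows "\<forall>\<^sub>F n in sequentially. measure M (Y n -` \<Gamma> \<inter> space M) \<le> exp (- (\<gamma> n * c))"
  using assms(2) unfolding ldp_elements_iff[OF assms(1)] using assms(3-) by blast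

section \<open>Good rate functions and the contraction principle\<close>

lemma rate_function_cong:
  assumes "\<And>x. x \<in> topspace X \<Longrightarrow> I x = I' x"
  shows "rate_function X I \<longleftrightarrow> rate_function X I'"
proof -
  have "{x \<in> topspace X. a < I x} = {x \<in> topspace X. a < I' x}" for a using assms by auto
  then show ?thesis by (simp add: rate_function_def)
qed

lemma good_rate_function_cong:
  assumes "\<And>x. x \<in> topspace X \<Longrightarrow> I x = I' x"
  shows "good_rate_function X I \<longleftrightarrow> good_rate_function X I'"
proof -
  have "{x \<in> topspace X. I x \<le> a} = {x \<in> topspace X. I' x \<le> a}" for a using assms by auto
  with rate_function_cong[of X I I', OF assms] show ?thesis by (simp add: good_rate_function_def)
qed

lemma ldp_elements_cong:
  assumes M: "prob_space M" and I: "\<And>x. x \<in> topspace X \<Longrightarrow> I x = I' x"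
    and Y: "\<And>n w. w \<in> space M \<Longrightarrow> Y n w = Y' n w"
  shows "ldp_elements M X \<gamma> Y I \<longleftrightarrow> ldp_elements M X \<gamma> Y' I'"
proof -
  have INF: "(INF x\<in>S. I x) = (INF x\<in>S. I' x)" if "closedin X S" for S
    using closedin_subset[OF that] I by (intro INF_cong) auto
  have I': "I x = I' x" if "openin X S" "x \<in> S" for S x
    using openin_subset that I by blast
  have vim: "Y n -` S \<inter> space M = Y' n -` S \<inter> space M" for n S
    using Y by auto
  have meas: "Y n \<in> measurable M (borel_of X) \<longleftrightarrow> Y' n \<in> measurable M (borel_of X)" for n
    using Y by (rule measurable_cong)
  show ?thesis
    unfolding ldp_elements_iff[OF M] vim meas using rate_function_cong[of X I I', OF I]
    by (simp add: INF I' cong: imp_cong conj_cong)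
qed

text \<open>
  In a Hausdorff space compact sets are closed, so compactness of the real level sets already implies lower
  semicontinuity.
\<close>

lemma good_rate_functionI:
  assumes "Hausdorff_space X"
    and compact: "\<And>a. a \<ge> 0 \<Longrightarrow> compactin X {x \<in> topspace X. I x \<le> ennreal a}"
  shows "good_rate_function X I"
  unfolding good_rate_function_def rate_function_def
proof (intro conjI allI impI compact)
  fix a :: ennreal
  show "openin X {x \<in> topspace X. a < I x}"
  proof (cases a)
    case (real r)
    have "closedin X {x \<in> topspace X. I x \<le> a}"
      using compactin_imp_closedin[OF assms(1) compact[OF real(1)]] real by simp
    moreover have "{x \<in> topspace X. a < I x} = topspace X - {x \<in> topspace X. I x \<le> a}" by auto
    ultimately show ?thesis by auto
  qed simp
qed

text \<open>
  Otherwise the part of \<open>C\<close> in the compact set where \<open>I\<close> is at most \<open>a +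
  1\<close> would be covered by the increasing open sets where \<open>I\<close> exceeds \<open>a + 1 / (n +
  1)\<close>; finitely many of them, hence a single one, would suffice, and the infimum would exceed
  \<open>a\<close>.
\<close>

lemma good_rate_function_attains_inf:
  assumes good: "good_rate_function X I" and C: "closedin X C" and a: "a \<ge> 0"
    and le: "(INF x\<in>C. I x) \<le> ennreal a"
  shows "\<exists>x\<in>C. I x \<le> ennreal a"
proof (rule ccontr)
  assume "\<not> ?thesis"
  then have gr: "\<And>x. x \<in> C \<Longrightarrow> ennreal a < I x" by (meson not_le)
  define K where "K = C \<inter> {x \<in> topspace X. I x \<le> ennreal (a + 1)}"
  have K: "compactin X K"
    unfolding K_def
  proof (rule closed_Int_compactin[OF C])
    have "a + 1 \<ge> 0" using a by simp
    then show "compactin X {x \<in> topspace X. I x \<le> ennreal (a + 1)}"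
      using good unfolding good_rate_function_def by blast
  qed
  define V where "V n = {x \<in> topspace X. ennreal (a + 1 / Suc n) < I x}" for n
  have "\<exists>n. ennreal (a + 1 / Suc n) < I x" if x: "x \<in> C" for x
  proof -
    obtain r where r: "ennreal a < ennreal r" "ennreal r < I x"
      using gr[OF x] by (metis dense ennreal_cases top.not_eq_extremum order.strict_trans)
    have ar: "a < r" using r(1) by (simp add: ennreal_less_iff a)
    then obtain n where n: "1 / Suc n < r - a"
      using nat_approx_posE[of "r - a"] by auto
    then have "ennreal (a + 1 / Suc n) \<le> ennreal r" by (intro ennreal_leI) auto
    then show ?thesis using r(2) le_less_trans by blast
  qed
  then have "K \<subseteq> \<Union>(range V)" using closedin_subset[OF C] by (auto simp: K_def V_def)
  moreover have "openin X (V n)" for n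
    using good by (simp add: V_def good_rate_function_def rate_function_def)
  ultimately obtain F where F: "finite F" "F \<subseteq> range V" "K \<subseteq> \<Union>F"
    using K unfolding compactin_def by (metis (no_types, lifting) imageE)
  then obtain N where N: "finite N" "F = V ` N" by (metis finite_subset_image)
  define m where "m = Max (insert 0 N)"
  have "ennreal (a + 1 / Suc m) \<le> I x" if x: "x \<in> C" for x
  proof (cases "x \<in> K")
    case True
    then obtain n where n: "n \<in> N" "x \<in> V n" using F N by blast
    then have "n \<le> m" using N by (simp add: m_def)
    then have "ennreal (a + 1 / Suc m) \<le> ennreal (a + 1 / Suc n)"
      by (intro ennreal_leI add_left_mono) (simp add: field_simps)
    then show ?thesis using n by (auto simp: V_def)
  next
    case False
    then have "ennreal (a + 1) < I x"
      using x closedin_subset[OF C] by (auto simp: K_def)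
    moreover have "ennreal (a + 1 / Suc m) \<le> ennreal (a + 1)"
      by (intro ennreal_leI) simp
    ultimately show ?thesis by (meson le_less_trans less_imp_le)
  qed
  then have "ennreal (a + 1 / Suc m) \<le> ennreal a"
    using le by (meson INF_greatest order_trans)
  then show False using a by (simp add: ennreal_le_iff)
qed

text \<open>
  Fibres of \<open>f\<close> are closed, so the infimum over a fibre is attained and the level sets of
  \<open>J\<close> are the images under \<open>f\<close> of the level sets of \<open>I\<close>; this is what
  makes \<open>J\<close> good. The two bounds are those for \<open>I\<close> on preimages.
\<close>

lemma ldp_elements_contraction:
  assumes M: "prob_space M" and ldp: "ldp_elements M X \<gamma> F I" and good: "good_rate_function X I"
    and f: "continuous_map X Y f" and Y: "Hausdorff_space Y"
  defines "J \<equiv> \<lambda>y. INF x\<in>{x \<in> topspace X. f x = y}. I x"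
  shows "ldp_elements M Y \<gamma> (\<lambda>n w. f (F n w)) J" and "good_rate_function Y J"
proof -
  note FM = ldp_elementsD(1)[OF M ldp]
  have ex: "\<exists>x\<in>topspace X. f x = y \<and> I x \<le> ennreal a"
    if "y \<in> topspace Y" "a \<ge> 0" "J y \<le> ennreal a" for y a
  proof -
    have "closedin X {x \<in> topspace X. f x \<in> {y}}"
      using that Y by (intro closedin_continuous_map_preimage[OF f]) (simp add: closedin_Hausdorff_singleton)
    then show ?thesis
      using good_rate_function_attains_inf[OF good _ that(2), of "{x \<in> topspace X. f x = y}"] that(3)
      by (auto simp: J_def)
  qed
  have le: "J (f x) \<le> I x" if "x \<in> topspace X" for x
    using that unfolding J_def by (intro INF_lower) simp
  have lev: "{y \<in> topspace Y. J y \<le> ennreal a} = f ` {x \<in> topspace X. I x \<le> ennreal a}"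
    if "a \<ge> 0" for a
  proof
    show "{y \<in> topspace Y. J y \<le> ennreal a} \<subseteq> f ` {x \<in> topspace X. I x \<le> ennreal a}"
      using ex[OF _ that] by blast
    show "f ` {x \<in> topspace X. I x \<le> ennreal a} \<subseteq> {y \<in> topspace Y. J y \<le> ennreal a}"
      using continuous_map_funspace[OF f] le by (force intro: order_trans)
  qed
  show goodJ: "good_rate_function Y J"
  proof (rule good_rate_functionI[OF Y])
    show "compactin Y {y \<in> topspace Y. J y \<le> ennreal a}" if "a \<ge> 0" for a
      unfolding lev[OF that] using good that
      by (intro image_compactin[OF _ f]) (simp add: good_rate_function_def)
  qed
  have vim: "(\<lambda>w. f (F n w)) -` S \<inter> space M = F n -` {x \<in> topspace X. f x \<in> S} \<inter> space M" for n S
    using measurable_space[OF FM[of n]] by auto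
  show "ldp_elements M Y \<gamma> (\<lambda>n w. f (F n w)) J"
    unfolding ldp_elements_iff[OF M] vim
  proof (intro conjI allI impI)
    show "(\<lambda>w. f (F n w)) \<in> measurable M (borel_of Y)" for n
      using measurable_compose[OF FM continuous_map_measurable_borel_of[OF f]] .
    show "\<gamma> n > 0" "filterlim \<gamma> at_top sequentially" for n by (rule ldp_elementsD[OF M ldp])+
    show "rate_function Y J" using goodJ by (simp add: good_rate_function_def)
  next
    fix \<Theta> y and c :: real
    assume \<Theta>: "openin Y \<Theta>" "y \<in> \<Theta>" and c: "c \<ge> 0" "J y < ennreal c"
    from c(2) obtain x where "x \<in> topspace X" "f x = y" "I x < ennreal c"
      unfolding J_def INF_less_iff by blast
    then show "\<forall>\<^sub>F n in sequentially. exp (- (\<gamma> n * c))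
        \<le> measure M (F n -` {x \<in> topspace X. f x \<in> \<Theta>} \<inter> space M)"
      using \<Theta> c(1) by (intro ldp_elements_lower[OF M ldp, where x = x] openin_continuous_map_preimage[OF f]) auto
  next
    fix \<Gamma> and c :: real
    assume \<Gamma>: "closedin Y \<Gamma>" and c: "c \<ge> 0" "ennreal c < (INF y\<in>\<Gamma>. J y)"
    have "(INF y\<in>\<Gamma>. J y) \<le> I x" if "x \<in> topspace X" "f x \<in> \<Gamma>" for x
      using that by (intro INF_lower2[of "f x"]) (auto simp: J_def intro: INF_lower)
    then have "(INF y\<in>\<Gamma>. J y) \<le> (INF x\<in>{x \<in> topspace X. f x \<in> \<Gamma>}. I x)"
      by (intro INF_greatest) auto
    with c have "ennreal c < (INF x\<in>{x \<in> topspace X. f x \<in> \<Gamma>}. I x)" by order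
    then show "\<forall>\<^sub>F n in sequentially. measure M (F n -` {x \<in> topspace X. f x \<in> \<Gamma>} \<inter> space M)
        \<le> exp (- (\<gamma> n * c))"
      by (intro ldp_elements_upper[OF M ldp] closedin_continuous_map_preimage[OF f \<Gamma>] c(1))
  qed
qed

section \<open>Large deviations of independent pairs\<close>

lemma indep_elements_prob:
  assumes M: "prob_space M" and ind: "indep_elements M S F R G"
    and F: "F \<in> measurable M S" and G: "G \<in> measurable M R"
    and U: "U \<in> sets S" and V: "V \<in> sets R"
  shows "measure M ((\<lambda>w. (F w, G w)) -` (U \<times> V) \<inter> space M)
     = measure M (F -` U \<inter> space M) * measure M (G -` V \<inter> space M)"
proof -
  interpret prob_space M by fact
  have "F -` U \<inter> space M \<in> sets (vimage_algebra (space M) F S)"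
       "G -` V \<inter> space M \<in> sets (vimage_algebra (space M) G R)"
    using U V by (auto intro: in_vimage_algebra)
  then have "prob ((F -` U \<inter> space M) \<inter> (G -` V \<inter> space M))
      = prob (F -` U \<inter> space M) * prob (G -` V \<inter> space M)"
    using ind unfolding indep_elements_def by (intro indep_setD)
  moreover have "(\<lambda>w. (F w, G w)) -` (U \<times> V) \<inter> space M = (F -` U \<inter> space M) \<inter> (G -` V \<inter> space M)"
    by auto
  ultimately show ?thesis by simp
qed

text \<open>
  Splits a strict lower bound on a sum of two extended values into real bounds on the summands. The
  alternative \<open>r = 0\<close> covers a vanishing summand, which has no strict lower bound; it is harmless
  later, as the bound \<open>exp 0\<close> on a probability is trivial.
\<close>

lemma less_add_ennrealE:
  fixes a :: real and u v :: ennreal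
  assumes "ennreal a < u + v" "a \<ge> 0"
  obtains r s where "0 \<le> r" "0 \<le> s" "r = 0 \<or> ennreal r < u" "s = 0 \<or> ennreal s < v" "a < r + s"
proof (cases "u = \<infinity>")
  case True
  then show ?thesis using assms(2) by (intro that[of "a + 1" 0]) auto
next
  case u: False
  show ?thesis
  proof (cases "v = \<infinity>")
    case True
    then show ?thesis using assms(2) by (intro that[of 0 "a + 1"]) auto
  next
    case False
    with u obtain x y where xy: "u = ennreal x" "v = ennreal y" "x \<ge> 0" "y \<ge> 0"
      by (metis ennreal_cases infinity_ennreal_def)
    have "a < x + y" using assms xy by (simp flip: ennreal_plus add: ennreal_less_iff)
    \<comment> \<open>Giving up \<open>d\<close> in each summand leaves \<open>a + d\<close>, a third of the gap above \<open>a\<close>.\<close>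
    define d where "d = (x + y - a) / 3"
    have d: "d > 0" "a = x + y - 3 * d" using \<open>a < x + y\<close> by (auto simp: d_def field_simps)
    show ?thesis
      using d xy by (intro that[of "max 0 (x - d)" "max 0 (y - d)"])
        (auto simp: ennreal_less_iff max_def)
  qed
qed

text \<open>
  The set where \<open>I\<close> exceeds a number between \<open>r\<close> and \<open>I x\<close> is open, and
  by regularity it contains a closed neighbourhood of \<open>x\<close>, to which the upper bound applies. For
  \<open>r = 0\<close> the whole space serves.
\<close>

lemma neighbourhood_prob_decay:
  assumes M: "prob_space M" and ldp: "ldp_elements M X \<gamma> F I" and X: "regular_space X"
    and x: "x \<in> topspace X" and r: "0 \<le> r" "r = 0 \<or> ennreal r < I x"
  shows "\<exists>U. openin X U \<and> x \<in> U \<and>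
     (\<forall>\<^sub>F n in sequentially. measure M (F n -` U \<inter> space M) \<le> exp (- (\<gamma> n * r)))"
proof (cases "r = 0")
  case True
  then show ?thesis using x by (intro exI[of _ "topspace X"]) (auto simp: prob_space.prob_le_1[OF M])
next
  case False
  note FM = ldp_elementsD(1)[OF M ldp]
  obtain q where q: "ennreal r < q" "q < I x" using False r(2) dense by blast
  define W where "W = {x \<in> topspace X. q < I x}"
  have W: "openin X W \<and> x \<in> W" using ldp_elementsD(4)[OF M ldp] q(2) x by (simp add: rate_function_def W_def)
  have "neighbourhood_base_of (closedin X) X" using X neighbourhood_base_of_closedin by blast
  from this[unfolded neighbourhood_base_of, rule_format, OF W]
  obtain U C where UC: "openin X U" "closedin X C" "x \<in> U" "U \<subseteq> C" "C \<subseteq> W"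
    by (elim exE conjE)
  have "q \<le> (INF x\<in>C. I x)" using UC(5) by (intro INF_greatest) (auto simp: W_def intro: less_imp_le)
  then have "\<forall>\<^sub>F n in sequentially. measure M (F n -` C \<inter> space M) \<le> exp (- (\<gamma> n * r))"
    using q(1) by (intro ldp_elements_upper[OF M ldp] UC(2) r(1)) order
  then have "\<forall>\<^sub>F n in sequentially. measure M (F n -` U \<inter> space M) \<le> exp (- (\<gamma> n * r))"
  proof eventually_elim
    case (elim n)
    interpret prob_space M by fact
    have "prob (F n -` U \<inter> space M) \<le> prob (F n -` C \<inter> space M)"
      using UC(4) measurable_sets[OF FM closedin_borel_of[OF UC(2)]]
      by (intro finite_measure_mono) auto
    with elim show ?case by simp
  qed
  with UC show ?thesis by blast
qed

text \<open>
  The level sets of the sum are closed and are contained in products of level sets.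
\<close>

lemma good_rate_function_add:
  assumes I: "good_rate_function X I" and J: "good_rate_function Y J"
  shows "good_rate_function (prod_topology X Y) (\<lambda>(x, y). I x + J y)"
proof -
  let ?P = "prod_topology X Y" and ?S = "\<lambda>(x, y). I x + J y"
  have op: "openin ?P {p \<in> topspace ?P. ennreal a < ?S p}" if a: "a \<ge> 0" for a
    unfolding openin_prod_topology_alt
  proof (intro allI impI)
    fix x y assume "(x, y) \<in> {p \<in> topspace ?P. ennreal a < ?S p}"
    then have xy: "x \<in> topspace X" "y \<in> topspace Y" and less: "ennreal a < I x + J y" by auto
    obtain r s where rs: "0 \<le> r" "0 \<le> s" "r = 0 \<or> ennreal r < I x" "s = 0 \<or> ennreal s < J y" "a < r + s"
      using less_add_ennrealE[OF less a] by blast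
    define U where "U = {x \<in> topspace X. r = 0 \<or> ennreal r < I x}"
    define V where "V = {y \<in> topspace Y. s = 0 \<or> ennreal s < J y}"
    have "openin X U" using I unfolding U_def good_rate_function_def rate_function_def
      by (cases "r = 0") auto
    moreover have "openin Y V" using J unfolding V_def good_rate_function_def rate_function_def
      by (cases "s = 0") auto
    moreover have "ennreal a < I x' + J y'" if "x' \<in> U" "y' \<in> V" for x' y'
    proof -
      have "ennreal a < ennreal (r + s)" using rs(5) a by (metis ennreal_less_iff)
      also have "\<dots> = ennreal r + ennreal s" using rs by simp
      also have "\<dots> \<le> I x' + J y'" using that by (intro add_mono) (auto simp: U_def V_def)
      finally show ?thesis .
    qed
    ultimately show "\<exists>U V. openin X U \<and> openin Y V \<and> x \<in> U \<and> y \<in> V \<and>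
        U \<times> V \<subseteq> {p \<in> topspace ?P. ennreal a < ?S p}"
      using xy rs by (intro exI[of _ U] exI[of _ V]) (auto simp: U_def V_def)
  qed
  have comp: "compactin ?P {p \<in> topspace ?P. ?S p \<le> ennreal a}" if a: "a \<ge> 0" for a
  proof (rule closed_compactin)
    show "compactin ?P ({x \<in> topspace X. I x \<le> ennreal a} \<times> {y \<in> topspace Y. J y \<le> ennreal a})"
      using I J a by (simp add: compactin_Times good_rate_function_def)
    have "?S (x, y) \<le> b \<Longrightarrow> I x \<le> b \<and> J y \<le> b" for x y b
      by (auto intro: order_trans[of _ "I x + J y"])
    then show "{p \<in> topspace ?P. ?S p \<le> ennreal a}
        \<subseteq> {x \<in> topspace X. I x \<le> ennreal a} \<times> {y \<in> topspace Y. J y \<le> ennreal a}"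
      by auto
    have "{p \<in> topspace ?P. ?S p \<le> ennreal a} = topspace ?P - {p \<in> topspace ?P. ennreal a < ?S p}" by auto
    then show "closedin ?P {p \<in> topspace ?P. ?S p \<le> ennreal a}"
      using closedin_diff[OF closedin_topspace op[OF a]] by (simp only:)
  qed
  have "openin ?P {p \<in> topspace ?P. a < ?S p}" for a
    using op by (cases a) auto
  with comp show ?thesis unfolding good_rate_function_def rate_function_def by blast
qed

text \<open>
  The lower bound uses boxes around single points. For the upper bound on a closed set
  \<open>\<Gamma>\<close>, call an open set small if its intersection with \<open>\<Gamma>\<close> has
  probability at most \<open>exp (- (\<gamma> n * a))\<close> eventually. Every point has a small
  neighbourhood: a box of small probability if the point is in \<open>\<Gamma>\<close>, the complement of
  \<open>\<Gamma>\<close> otherwise. Compactness and Wallace's theorem reduce \<open>\<Gamma>\<close> to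
  finitely many small sets and two sets that depend on one coordinate only.
\<close>

lemma ldp_elements_Pair:
  assumes M: "prob_space M" and F: "ldp_elements M X \<gamma> F I" and G: "ldp_elements M Y \<gamma> G J"
    and I: "good_rate_function X I" and J: "good_rate_function Y J"
    and X: "regular_space X" "second_countable X" and Y: "regular_space Y" "second_countable Y"
    and ind: "\<And>n. indep_elements M (borel_of X) (F n) (borel_of Y) (G n)"
  shows "ldp_elements M (prod_topology X Y) \<gamma> (\<lambda>n w. (F n w, G n w)) (\<lambda>(x, y). I x + J y)"
proof -
  interpret prob_space M by fact
  let ?P = "prod_topology X Y" and ?S = "\<lambda>(x, y). I x + J y" and ?H = "\<lambda>n w. (F n w, G n w)"
  note FM = ldp_elementsD(1)[OF M F] and GM = ldp_elementsD(1)[OF M G]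
    and \<gamma> = ldp_elementsD(2)[OF M F] and \<gamma>_top = ldp_elementsD(3)[OF M F]
  have HM: "?H n \<in> measurable M (borel_of ?P)" for n
    by (rule measurable_Pair_borel_of[OF FM GM X(2) Y(2)])
  have ev: "?H n -` S \<inter> space M \<in> events" if "openin ?P S \<or> closedin ?P S" for n S
    using that measurable_sets[OF HM] openin_borel_of closedin_borel_of by blast
  have box: "prob (?H n -` (U \<times> V) \<inter> space M) = prob (F n -` U \<inter> space M) * prob (G n -` V \<inter> space M)"
    if "openin X U" "openin Y V" for n U V
    using that by (intro indep_elements_prob[OF M ind FM GM] openin_borel_of)
  show ?thesis
    unfolding ldp_elements_iff[OF M]
  proof (intro conjI allI impI HM \<gamma>)
    show "filterlim \<gamma> at_top sequentially" by (rule \<gamma>_top)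
    show "rate_function ?P ?S" using good_rate_function_add[OF I J] by (simp add: good_rate_function_def)
  next
    fix \<Theta> p and c :: real
    assume \<Theta>: "openin ?P \<Theta>" "p \<in> \<Theta>" and c: "0 \<le> c" "?S p < ennreal c"
    obtain x y where p: "p = (x, y)" by (cases p)
    obtain U V where UV: "openin X U" "openin Y V" "x \<in> U" "y \<in> V" "U \<times> V \<subseteq> \<Theta>"
      using \<Theta> unfolding p openin_prod_topology_alt by metis
    have less: "I x + J y < ennreal c" using c p by simp
    then have "I x + J y < top" by (rule order.strict_trans) simp
    then obtain r s where rs: "I x = ennreal r" "J y = ennreal s" "r \<ge> 0" "s \<ge> 0"
      by (cases "I x"; cases "J y") auto
    have "r + s < c" using less rs by (simp add: ennreal_less_iff flip: ennreal_plus)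
    define d where "d = (c - r - s) / 2"
    have d: "d > 0" "c = (r + d) + (s + d)" using \<open>r + s < c\<close> by (auto simp: d_def field_simps)
    have "I x < ennreal (r + d)" "J y < ennreal (s + d)" using rs d by (auto simp: ennreal_less_iff)
    moreover have "r + d \<ge> 0" "s + d \<ge> 0" using rs d by auto
    ultimately have "\<forall>\<^sub>F n in sequentially. exp (- (\<gamma> n * (r + d))) \<le> prob (F n -` U \<inter> space M)"
      "\<forall>\<^sub>F n in sequentially. exp (- (\<gamma> n * (s + d))) \<le> prob (G n -` V \<inter> space M)"
      using ldp_elements_lower[OF M F UV(1,3)] ldp_elements_lower[OF M G UV(2,4)] by blast+
    then show "\<forall>\<^sub>F n in sequentially. exp (- (\<gamma> n * c)) \<le> prob (?H n -` \<Theta> \<inter> space M)"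
    proof eventually_elim
      case (elim n)
      have "exp (- (\<gamma> n * c)) = exp (- (\<gamma> n * (r + d))) * exp (- (\<gamma> n * (s + d)))"
        by (simp add: d(2) algebra_simps flip: exp_add)
      also have "\<dots> \<le> prob (F n -` U \<inter> space M) * prob (G n -` V \<inter> space M)"
        using elim by (intro mult_mono) auto
      also have "\<dots> = prob (?H n -` (U \<times> V) \<inter> space M)" using box UV by simp
      also have "\<dots> \<le> prob (?H n -` \<Theta> \<inter> space M)"
        using UV(5) \<Theta>(1) by (intro finite_measure_mono ev) auto
      finally show ?case .
    qed
  next
    fix \<Gamma> and c :: real
    assume \<Gamma>: "closedin ?P \<Gamma>" and c: "0 \<le> c" "ennreal c < (INF p\<in>\<Gamma>. ?S p)"
    \<comment> \<open>Two margins are used: level sets are taken at \<open>b\<close>, single events decay at rate \<open>a < b\<close>, and the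
      gap between \<open>a\<close> and \<open>c\<close> absorbs the number of events.\<close>
    obtain e where e: "ennreal c < e" "e < (INF p\<in>\<Gamma>. ?S p)" using c(2) dense by blast
    then obtain b where "e = ennreal b" "b \<ge> 0" by (cases e) auto
    with e c have b: "c < b" "ennreal b < (INF p\<in>\<Gamma>. ?S p)" by (simp_all add: ennreal_less_iff)
    obtain a where a: "c < a" "a < b" using b(1) dense by blast
    have nn: "0 \<le> a" "0 \<le> b" using a c by auto
    let ?K = "{x \<in> topspace X. I x \<le> ennreal b}" and ?L = "{y \<in> topspace Y. J y \<le> ennreal b}"
    define small where "small W \<longleftrightarrow>
      (\<forall>\<^sub>F n in sequentially. prob (?H n -` (W \<inter> \<Gamma>) \<inter> space M) \<le> exp (- (\<gamma> n * a)))" for W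
    have cover: "\<exists>W. openin ?P W \<and> p \<in> W \<and> small W" if p: "p \<in> topspace ?P" for p
    proof (cases "p \<in> \<Gamma>")
      case False
      have "(topspace ?P - \<Gamma>) \<inter> \<Gamma> = {}" by blast
      then have "small (topspace ?P - \<Gamma>)" unfolding small_def by (simp only: vimage_empty) simp
      moreover have "openin ?P (topspace ?P - \<Gamma>)" using \<Gamma> by (rule openin_diff[OF openin_topspace])
      ultimately show ?thesis using p False by (intro exI[of _ "topspace ?P - \<Gamma>"]) blast
    next
      case True
      obtain x y where xy: "p = (x, y)" by (cases p)
      have "ennreal b < I x + J y" using b(2) INF_lower[OF True, of ?S] by (simp add: xy)
      then obtain r s where rs: "0 \<le> r" "0 \<le> s" "r = 0 \<or> ennreal r < I x" "s = 0 \<or> ennreal s < J y" "b < r + s"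
        using less_add_ennrealE nn(2) by blast
      have "x \<in> topspace X" "y \<in> topspace Y" using p by (auto simp: xy)
      then obtain U V where U: "openin X U" "x \<in> U"
          "\<forall>\<^sub>F n in sequentially. prob (F n -` U \<inter> space M) \<le> exp (- (\<gamma> n * r))"
        and V: "openin Y V" "y \<in> V"
          "\<forall>\<^sub>F n in sequentially. prob (G n -` V \<inter> space M) \<le> exp (- (\<gamma> n * s))"
        using neighbourhood_prob_decay[OF M F X(1) _ rs(1,3)] neighbourhood_prob_decay[OF M G Y(1) _ rs(2,4)]
        by blast
      have UV: "openin ?P (U \<times> V)" using U V by (simp add: openin_prod_Times_iff)
      have "small (U \<times> V)"
        unfolding small_def using U(3) V(3)
      proof eventually_elim
        case (elim n)
        have "prob (?H n -` (U \<times> V \<inter> \<Gamma>) \<inter> space M) \<le> prob (?H n -` (U \<times> V) \<inter> space M)"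
          using UV by (intro finite_measure_mono ev) auto
        also have "\<dots> = prob (F n -` U \<inter> space M) * prob (G n -` V \<inter> space M)" using box U V by simp
        also have "\<dots> \<le> exp (- (\<gamma> n * r)) * exp (- (\<gamma> n * s))"
          using elim by (intro mult_mono) auto
        also have "\<dots> = exp (- (\<gamma> n * (r + s)))" by (simp add: algebra_simps flip: exp_add)
        also have "\<dots> \<le> exp (- (\<gamma> n * a))" using \<gamma>[of n] a rs by simp
        finally show ?case .
      qed
      with UV U V show ?thesis by (intro exI[of _ "U \<times> V"]) (simp add: xy)
    qed
    then obtain N where N: "\<And>p. p \<in> topspace ?P \<Longrightarrow> openin ?P (N p) \<and> p \<in> N p \<and> small (N p)"
      by metis
    have KL: "compactin X ?K" "compactin Y ?L" using I J nn by (auto simp: good_rate_function_def)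
    have KL_prod: "compactin ?P (?K \<times> ?L)" using KL by (simp add: compactin_Times)
    have "\<exists>\<F>. finite \<F> \<and> \<F> \<subseteq> N ` (?K \<times> ?L) \<and> ?K \<times> ?L \<subseteq> \<Union>\<F>"
      using N by (intro compactinD[OF KL_prod]) auto
    then obtain \<W> where \<W>: "finite \<W>" "\<W> \<subseteq> N ` (?K \<times> ?L)" "?K \<times> ?L \<subseteq> \<Union>\<W>"
      by (elim exE conjE)
    have \<W>_op: "openin ?P W" and \<W>_small: "small W" if "W \<in> \<W>" for W
      using that \<W>(2) N by auto
    obtain U V where UV: "openin X U" "openin Y V" "?K \<subseteq> U" "?L \<subseteq> V" "U \<times> V \<subseteq> \<Union>\<W>"
      using Wallace_theorem_prod_topology[OF KL _ \<W>(3)] \<W>_op by blast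
    have ab: "ennreal a < ennreal b" using a nn by (simp add: ennreal_less_iff)
    have "\<forall>\<^sub>F n in sequentially. prob (F n -` (topspace X - U) \<inter> space M) \<le> exp (- (\<gamma> n * a))"
    proof -
      have "ennreal b \<le> (INF x\<in>topspace X - U. I x)" using UV(3) by (intro INF_greatest) force
      then have "ennreal a < (INF x\<in>topspace X - U. I x)" using ab by order
      moreover have "closedin X (topspace X - U)" using UV(1) by blast
      ultimately show ?thesis by (intro ldp_elements_upper[OF M F] nn)
    qed
    moreover have "\<forall>\<^sub>F n in sequentially. prob (G n -` (topspace Y - V) \<inter> space M) \<le> exp (- (\<gamma> n * a))"
    proof -
      have "ennreal b \<le> (INF y\<in>topspace Y - V. J y)" using UV(4) by (intro INF_greatest) force
      then have "ennreal a < (INF y\<in>topspace Y - V. J y)" using ab by order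
      moreover have "closedin Y (topspace Y - V)" using UV(2) by blast
      ultimately show ?thesis by (intro ldp_elements_upper[OF M G] nn)
    qed
    moreover have "\<forall>\<^sub>F n in sequentially. \<forall>W\<in>\<W>. prob (?H n -` (W \<inter> \<Gamma>) \<inter> space M) \<le> exp (- (\<gamma> n * a))"
      using \<W>(1) \<W>_small by (auto simp: small_def intro: eventually_ball_finite)
    \<comment> \<open>Eventually \<open>card \<W> + 2\<close> is at most \<open>exp (\<gamma> n * (a - c))\<close>.\<close>
    moreover have "\<forall>\<^sub>F n in sequentially. ln (real (card \<W>) + 2) / (a - c) \<le> \<gamma> n"
      using \<gamma>_top unfolding filterlim_at_top by blast
    ultimately show "\<forall>\<^sub>F n in sequentially. prob (?H n -` \<Gamma> \<inter> space M) \<le> exp (- (\<gamma> n * c))"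
    proof eventually_elim
      case (elim n)
      let ?A = "F n -` (topspace X - U) \<inter> space M" and ?B = "G n -` (topspace Y - V) \<inter> space M"
        and ?C = "\<lambda>W. ?H n -` (W \<inter> \<Gamma>) \<inter> space M"
      have evA: "?A \<in> events" "?B \<in> events"
        using UV by (auto intro!: measurable_sets[OF FM] measurable_sets[OF GM] closedin_borel_of)
      have evC: "?C W \<in> events" if "W \<in> \<W>" for W
      proof -
        have "W \<inter> \<Gamma> \<in> sets (borel_of ?P)"
          using \<W>_op[OF that] \<Gamma> openin_borel_of closedin_borel_of by blast
        then show ?thesis by (rule measurable_sets[OF HM])
      qed
      have "?H n -` \<Gamma> \<inter> space M \<subseteq> (?A \<union> ?B) \<union> (\<Union>W\<in>\<W>. ?C W)"
        using UV(5) measurable_space[OF FM[of n]] measurable_space[OF GM[of n]] by fastforce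
      then have "prob (?H n -` \<Gamma> \<inter> space M) \<le> prob ((?A \<union> ?B) \<union> (\<Union>W\<in>\<W>. ?C W))"
        using evA evC \<W>(1) by (intro finite_measure_mono sets.Un sets.finite_UN) auto
      also have "\<dots> \<le> prob (?A \<union> ?B) + prob (\<Union>W\<in>\<W>. ?C W)"
        using evA evC \<W>(1) by (intro measure_Un_le sets.Un sets.finite_UN) auto
      also have "\<dots> \<le> (prob ?A + prob ?B) + (\<Sum>W\<in>\<W>. prob (?C W))"
        using evA evC \<W>(1) by (intro add_mono measure_Un_le measure_UNION_le) auto
      also have "\<dots> \<le> (exp (- (\<gamma> n * a)) + exp (- (\<gamma> n * a))) + (\<Sum>W\<in>\<W>. exp (- (\<gamma> n * a)))"
        using elim by (intro add_mono sum_mono) auto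
      also have "\<dots> = (real (card \<W>) + 2) * exp (- (\<gamma> n * a))" by (simp add: algebra_simps)
      also have "\<dots> \<le> exp (\<gamma> n * (a - c)) * exp (- (\<gamma> n * a))"
      proof (rule mult_right_mono)
        have "ln (real (card \<W>) + 2) \<le> \<gamma> n * (a - c)"
          using elim(4) a(1) by (simp add: pos_divide_le_eq)
        then have "exp (ln (real (card \<W>) + 2)) \<le> exp (\<gamma> n * (a - c))"
          by (simp only: exp_le_cancel_iff)
        moreover have "real (card \<W>) + 2 > 0" by (simp add: add_nonneg_pos)
        ultimately show "real (card \<W>) + 2 \<le> exp (\<gamma> n * (a - c))" by (simp only: exp_ln)
      qed simp
      also have "\<dots> = exp (- (\<gamma> n * c))" by (simp add: algebra_simps flip: exp_add)
      finally show ?case .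
    qed
  qed
qed

section \<open>Continuous Gaussian processes\<close>

text \<open>
  Rounding to a countable grid turns a continuous process into a limit of processes that take countably many
  time arguments. Rounding down keeps the grid point in the time interval.
\<close>

definition grid_floor :: "nat \<Rightarrow> real \<Rightarrow> real" where
  "grid_floor n t = real_of_int \<lfloor>t * real (Suc n)\<rfloor> / real (Suc n)"

lemma grid_floor_bounds:
  assumes "0 \<le> t"
  shows "0 \<le> grid_floor n t" "grid_floor n t \<le> t" "t - 1 / real (Suc n) \<le> grid_floor n t"
proof -
  let ?m = "real (Suc n)"
  have m: "?m > 0" by simp
  show "0 \<le> grid_floor n t" using assms by (simp add: grid_floor_def)
  show "grid_floor n t \<le> t"
    unfolding grid_floor_def using m by (subst pos_divide_le_eq) (rule m, rule of_int_floor_le)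
  have "t * ?m - 1 \<le> real_of_int \<lfloor>t * ?m\<rfloor>" by linarith
  then have "(t * ?m - 1) / ?m \<le> grid_floor n t"
    unfolding grid_floor_def using m by (intro divide_right_mono) auto
  moreover have "(t * ?m - 1) / ?m = t - 1 / ?m" using m by (simp only: diff_divide_distrib nonzero_mult_div_cancel_right)
  ultimately show "t - 1 / ?m \<le> grid_floor n t" by simp
qed

lemma grid_floor_tendsto: "0 \<le> t \<Longrightarrow> (\<lambda>n. grid_floor n t) \<longlonglongrightarrow> t"
proof (rule tendsto_sandwich[of "\<lambda>n. t - 1 / real (Suc n)" _ _ "\<lambda>_. t"])
  have "(\<lambda>n. t - 1 / real (Suc n)) \<longlonglongrightarrow> t - 0"
    by (intro tendsto_diff tendsto_const LIMSEQ_Suc[OF lim_1_over_n])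
  then show "(\<lambda>n. t - 1 / real (Suc n)) \<longlonglongrightarrow> t" by simp
  assume t: "0 \<le> t"
  show "\<forall>\<^sub>F n in sequentially. t - 1 / real (Suc n) \<le> grid_floor n t"
    by (intro always_eventually allI grid_floor_bounds(3) t)
  show "\<forall>\<^sub>F n in sequentially. grid_floor n t \<le> t"
    by (intro always_eventually allI grid_floor_bounds(2) t)
qed simp

lemma continuous_path_grid_tendsto:
  assumes "continuous_on {0..T} f" "t \<in> {0..T}"
  shows "(\<lambda>n. f (grid_floor n t)) \<longlonglongrightarrow> (f t :: real)"
  using assms grid_floor_bounds(1,2)[of t]
  by (intro continuous_on_tendsto_compose[OF assms(1) grid_floor_tendsto]) (auto intro!: always_eventually order_trans[of "grid_floor _ t" t T])

text \<open>
  Joint measurability follows from that at fixed times by approximating the time from the grid: at each level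
  the grid point is a measurable function with countably many values.
\<close>

lemma continuous_process_measurable_pair:
  fixes U :: "'w \<Rightarrow> real \<Rightarrow> real"
  assumes meas: "\<And>t. t \<in> {0..T} \<Longrightarrow> (\<lambda>w. U w t) \<in> borel_measurable N"
    and cont: "\<And>w. w \<in> space N \<Longrightarrow> continuous_on {0..T} (U w)"
    and \<nu>: "sets \<nu> = sets (restrict_space borel {0..T})"
  shows "(\<lambda>(w, t). U w t) \<in> borel_measurable (N \<Otimes>\<^sub>M \<nu>)"
proof -
  have sp: "space \<nu> = {0..T}" using sets_eq_imp_space_eq[OF \<nu>] by (simp add: space_restrict_space)
  have id_meas: "(\<lambda>t. t) \<in> borel_measurable \<nu>"
    using \<nu> by (simp cong: measurable_cong_sets) (simp add: measurable_restrict_space1)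
  show ?thesis
  proof (rule borel_measurable_LIMSEQ_real)
    fix p assume "p \<in> space (N \<Otimes>\<^sub>M \<nu>)"
    then show "(\<lambda>n. U (fst p) (grid_floor n (snd p))) \<longlonglongrightarrow> (case p of (w, t) \<Rightarrow> U w t)"
      by (cases p) (auto simp: space_pair_measure sp intro: continuous_path_grid_tendsto[OF cont])
  next
    fix n
    define h where "h = (\<lambda>(i::int) (p::'w \<times> real). let s = real_of_int i / real (Suc n) in
        if s \<in> {0..T} then U (fst p) s else 0)"
    have "h i \<in> borel_measurable (N \<Otimes>\<^sub>M \<nu>)" for i
    proof (cases "real_of_int i / real (Suc n) \<in> {0..T}")
      case True
      then show ?thesis
        using measurable_compose[OF measurable_fst meas[OF True]] by (simp add: h_def Let_def)
    qed (auto simp: h_def Let_def)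
    moreover have "(\<lambda>p. \<lfloor>snd p * real (Suc n)\<rfloor>) \<in> measurable (N \<Otimes>\<^sub>M \<nu>) (count_space UNIV)"
      using measurable_compose[OF measurable_snd id_meas] by measurable
    ultimately have "(\<lambda>p. h \<lfloor>snd p * real (Suc n)\<rfloor> p) \<in> borel_measurable (N \<Otimes>\<^sub>M \<nu>)"
      by (rule measurable_compose_countable)
    moreover have "h \<lfloor>snd p * real (Suc n)\<rfloor> p = U (fst p) (grid_floor n (snd p))"
      if "p \<in> space (N \<Otimes>\<^sub>M \<nu>)" for p
    proof -
      have t: "0 \<le> snd p" "snd p \<le> T" using that by (auto simp: space_pair_measure sp)
      then have "grid_floor n (snd p) \<in> {0..T}"
        using grid_floor_bounds(1,2)[OF t(1), of n] by auto
      then show ?thesis by (simp add: h_def Let_def grid_floor_def)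
    qed
    ultimately show "(\<lambda>p. U (fst p) (grid_floor n (snd p))) \<in> borel_measurable (N \<Otimes>\<^sub>M \<nu>)"
      by (simp cong: measurable_cong)
  qed
qed

text \<open>
  A Gaussian variable that stays in a bounded interval with probability at least one half has bounded
  variance, as its density is at most \<open>1 / \<sigma>\<close> and therefore \<open>1 / 2 \<le> 2 K /
  \<sigma>\<close>.
\<close>

lemma centered_gaussian_square:
  assumes N: "prob_space N" and Y: "centered_gaussian N Y"
    and K: "K > 0" "measure N {w \<in> space N. \<bar>Y w\<bar> \<le> K} \<ge> 1 / 2"
  shows "integrable N (\<lambda>w. (Y w)\<^sup>2)" "(\<integral>w. (Y w)\<^sup>2 \<partial>N) \<le> 16 * K\<^sup>2"
proof -
  interpret prob_space N by fact
  have Ym: "Y \<in> borel_measurable N" using Y by (simp add: centered_gaussian_def)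
  have "integrable N (\<lambda>w. (Y w)\<^sup>2) \<and> (\<integral>w. (Y w)\<^sup>2 \<partial>N) \<le> 16 * K\<^sup>2"
  proof (cases "distr N borel Y = return borel 0")
    case True
    have "AE y in distr N borel Y. y = 0" unfolding True by (subst AE_return) auto
    then have "AE w in N. Y w = 0" by (rule AE_distrD[OF Ym])
    then have ae: "AE w in N. (Y w)\<^sup>2 = 0" by eventually_elim simp
    have "integrable N (\<lambda>w. (Y w)\<^sup>2) \<longleftrightarrow> integrable N (\<lambda>w. 0 :: real)"
      by (rule integrable_cong_AE) (use Ym ae in measurable)
    moreover have "(\<integral>w. (Y w)\<^sup>2 \<partial>N) = (\<integral>w. 0 \<partial>N)"
      by (rule integral_cong_AE) (use Ym ae in measurable)
    ultimately show ?thesis by simp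
  next
    case False
    then obtain \<sigma> where \<sigma>: "\<sigma> > 0" "distr N borel Y = density lborel (\<lambda>x. ennreal (normal_density 0 \<sigma> x))"
      using Y by (auto simp: centered_gaussian_def)
    have "integrable lborel (\<lambda>x. normal_density 0 \<sigma> x * x\<^sup>2)"
      using integrable_normal_moment[OF \<sigma>(1), of 0 2] by simp
    then have "integrable (distr N borel Y) (\<lambda>x. x\<^sup>2)"
      unfolding \<sigma>(2) by (subst integrable_density) (auto simp: normal_density_nonneg)
    then have int: "integrable N (\<lambda>w. (Y w)\<^sup>2)" using Ym by (subst (asm) integrable_distr_eq) auto
    have "(\<integral>w. (Y w)\<^sup>2 \<partial>N) = (\<integral>x. x\<^sup>2 \<partial>distr N borel Y)" using Ym by (subst integral_distr) auto
    also have "\<dots> = (\<integral>x. normal_density 0 \<sigma> x * x\<^sup>2 \<partial>lborel)"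
      unfolding \<sigma>(2) by (subst integral_density) (auto simp: normal_density_nonneg)
    also have "\<dots> = \<sigma>\<^sup>2"
      using integral_normal_moment_even[OF \<sigma>(1), of 0 1] by (simp add: fact_2 numeral_2_eq_2[symmetric])
    finally have var: "(\<integral>w. (Y w)\<^sup>2 \<partial>N) = \<sigma>\<^sup>2" .
    have dens: "normal_density 0 \<sigma> x \<le> 1 / \<sigma>" for x
    proof -
      have "normal_density 0 \<sigma> x \<le> 1 / sqrt (2 * pi * \<sigma>\<^sup>2)"
        unfolding normal_density_def by (simp add: mult_left_le divide_right_mono)
      also have "sqrt (2 * pi * \<sigma>\<^sup>2) = sqrt (2 * pi) * \<sigma>" using \<sigma>(1) by (simp add: real_sqrt_mult)
      also have "1 / (sqrt (2 * pi) * \<sigma>) \<le> 1 / \<sigma>"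
      proof -
        have "1 \<le> 2 * pi" using pi_gt3 by linarith
        then have "1 \<le> sqrt (2 * pi)" by simp
        then have "1 * \<sigma> \<le> sqrt (2 * pi) * \<sigma>" using \<sigma>(1) by (intro mult_right_mono) auto
        then show ?thesis using \<sigma>(1) by (intro divide_left_mono) auto
      qed
      finally show ?thesis .
    qed
    have "ennreal (1 / 2) \<le> emeasure N {w \<in> space N. \<bar>Y w\<bar> \<le> K}"
      unfolding emeasure_eq_measure by (rule ennreal_leI[OF K(2)])
    also have "\<dots> = emeasure (distr N borel Y) {- K..K}"
      using Ym by (subst emeasure_distr) (auto intro!: arg_cong[of _ _ "emeasure N"])
    also have "\<dots> = (\<integral>\<^sup>+x. ennreal (normal_density 0 \<sigma> x) * indicator {- K..K} x \<partial>lborel)"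
      unfolding \<sigma>(2) by (subst emeasure_density) auto
    also have "\<dots> \<le> (\<integral>\<^sup>+x. ennreal (1 / \<sigma>) * indicator {- K..K} x \<partial>lborel)"
      using dens by (intro nn_integral_mono mult_right_mono ennreal_leI) auto
    also have "\<dots> = ennreal (1 / \<sigma> * (2 * K))"
      using K(1) \<sigma>(1) by (simp add: nn_integral_cmult_indicator flip: ennreal_mult)
    finally have le: "ennreal (1 / 2) \<le> ennreal (1 / \<sigma> * (2 * K))" .
    have "0 \<le> 1 / \<sigma> * (2 * K)" using K(1) \<sigma>(1) by simp
    from iffD1[OF ennreal_le_iff[OF this] le] have "1 / 2 \<le> 1 / \<sigma> * (2 * K)" .
    then have "\<sigma> \<le> 4 * K" using \<sigma>(1) by (simp add: field_simps)
    then have "\<sigma>\<^sup>2 \<le> (4 * K)\<^sup>2" using \<sigma>(1) by (intro power_mono) auto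
    then show ?thesis using int var by (simp add: power_mult_distrib)
  qed
  then show "integrable N (\<lambda>w. (Y w)\<^sup>2)" "(\<integral>w. (Y w)\<^sup>2 \<partial>N) \<le> 16 * K\<^sup>2" by auto
qed

lemma continuous_gaussian_process_measurable:
  assumes "continuous_gaussian_process N T U" "t \<in> {0..T}"
  shows "(\<lambda>w. U w t) \<in> borel_measurable N"
  using assms by (auto simp: continuous_gaussian_process_def centered_gaussian_process_def)

lemma continuous_gaussian_process_marginal:
  fixes U :: "'w \<Rightarrow> real \<Rightarrow> real"
  assumes "continuous_gaussian_process N T U" "t \<in> {0..T}"
  shows "centered_gaussian N (\<lambda>w. U w t)"
proof -
  have "\<forall>F c. finite F \<longrightarrow> F \<subseteq> {0..T} \<longrightarrow> centered_gaussian N (\<lambda>w. \<Sum>t\<in>F. c t \<bullet> U w t)"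
    using assms(1) unfolding continuous_gaussian_process_def centered_gaussian_process_def by (elim conjE)
  from this[rule_format, of "{t}" "\<lambda>_. 1"] assms(2) show ?thesis by simp
qed

text \<open>
  Continuous paths are bounded, so some constant \<open>K\<close> bounds the whole path with probability above
  one half; the same \<open>K\<close> then serves for all times. The bound is imposed on a countable grid
  only, which keeps the event measurable, and extends to all times by continuity.
\<close>

lemma continuous_gaussian_process_bounded_variance:
  fixes U :: "'w \<Rightarrow> real \<Rightarrow> real"
  assumes U: "continuous_gaussian_process N T U"
  obtains C where "\<And>t. t \<in> {0..T} \<Longrightarrow> integrable N (\<lambda>w. (U w t)\<^sup>2)"
    "\<And>t. t \<in> {0..T} \<Longrightarrow> (\<integral>w. (U w t)\<^sup>2 \<partial>N) \<le> C"
proof -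
  interpret prob_space N using U by (simp add: continuous_gaussian_process_def)
  have cont: "continuous_on {0..T} (U w)" if "w \<in> space N" for w
    using U that by (simp add: continuous_gaussian_process_def)
  note meas = continuous_gaussian_process_measurable[OF U]
  define D where "D = (\<lambda>(i::int, n). real_of_int i / real (Suc n)) ` UNIV \<inter> {0..T}"
  have D: "countable D" "D \<subseteq> {0..T}" by (auto simp: D_def)
  define A where "A K = {w \<in> space N. \<forall>t\<in>D. \<bar>U w t\<bar> \<le> real K}" for K :: nat
  have A_meas: "A K \<in> events" for K
  proof -
    have "A K = space N \<inter> (\<Inter>t\<in>D. {w \<in> space N. \<bar>U w t\<bar> \<le> real K}) \<or> D = {}"
      by (auto simp: A_def)
    moreover have "{w \<in> space N. \<bar>U w t\<bar> \<le> real K} \<in> events" if "t \<in> D" for t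
      using meas[of t] D(2) that by (auto intro!: borel_measurable_le borel_measurable_abs)
    ultimately show ?thesis
      using D(1) by (cases "D = {}") (auto simp: A_def intro!: sets.Int sets.countable_INT')
  qed
  have "(\<Union>K. A K) = space N"
  proof
    show "space N \<subseteq> (\<Union>K. A K)"
    proof
      fix w assume w: "w \<in> space N"
      have "bounded (U w ` {0..T})"
        by (intro compact_imp_bounded compact_continuous_image cont w compact_Icc)
      then obtain B where "\<forall>x\<in>U w ` {0..T}. norm x \<le> B" unfolding bounded_iff by blast
      then have B: "\<bar>U w t\<bar> \<le> B" if "t \<in> {0..T}" for t using that by simp
      obtain K :: nat where "B \<le> real K" using real_arch_simple by blast
      then have "w \<in> A K" using w B D(2) by (force simp: A_def)
      then show "w \<in> (\<Union>K. A K)" by blast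
    qed
  qed (auto simp: A_def)
  moreover have "incseq A" by (rule incseq_SucI) (auto simp: A_def intro: order_trans)
  ultimately have "(\<lambda>K. prob (A K)) \<longlonglongrightarrow> 1"
    using finite_Lim_measure_incseq[of A] A_meas by (auto simp: prob_space)
  then have "\<forall>\<^sub>F K in sequentially. 1 / 2 < prob (A K)" by (rule order_tendstoD) simp
  then have "\<forall>\<^sub>F K in sequentially. 1 / 2 < prob (A K) \<and> 0 < K"
    using eventually_gt_at_top[of "0::nat"] by eventually_elim simp
  then obtain K where K: "1 / 2 < prob (A K)" "0 < K" by (auto simp: eventually_sequentially)
  have big: "1 / 2 \<le> prob {w \<in> space N. \<bar>U w t\<bar> \<le> real K}" if t: "t \<in> {0..T}" for t
  proof -
    have "\<bar>U w t\<bar> \<le> real K" if w: "w \<in> A K" for w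
    proof (rule LIMSEQ_le_const2)
      have "w \<in> space N" using w by (simp add: A_def)
      then show "(\<lambda>n. \<bar>U w (grid_floor n t)\<bar>) \<longlonglongrightarrow> \<bar>U w t\<bar>"
        by (intro tendsto_rabs continuous_path_grid_tendsto[OF cont t])
      have "grid_floor n t \<in> D" for n
        using t grid_floor_bounds(1,2)[of t n] by (auto simp: D_def grid_floor_def image_iff)
      then show "\<exists>M. \<forall>n\<ge>M. \<bar>U w (grid_floor n t)\<bar> \<le> real K" using w by (auto simp: A_def)
    qed
    then have "A K \<subseteq> {w \<in> space N. \<bar>U w t\<bar> \<le> real K}" by (auto simp: A_def)
    then have "prob (A K) \<le> prob {w \<in> space N. \<bar>U w t\<bar> \<le> real K}"
      using meas[OF t] by (intro finite_measure_mono borel_measurable_le borel_measurable_abs) auto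
    then show ?thesis using K by linarith
  qed
  show thesis
  proof (rule that)
    fix t assume t: "t \<in> {0..T}"
    note * = centered_gaussian_square[OF prob_space_axioms continuous_gaussian_process_marginal[OF U t] _ big[OF t]]
    show "integrable N (\<lambda>w. (U w t)\<^sup>2)" "(\<integral>w. (U w t)\<^sup>2 \<partial>N) \<le> 16 * (real K)\<^sup>2"
      using * K by auto
  qed
qed

lemma integrable_mult_of_squares:
  fixes f g :: "'a \<Rightarrow> real"
  assumes "f \<in> borel_measurable M" "g \<in> borel_measurable M"
    "integrable M (\<lambda>x. (f x)\<^sup>2)" "integrable M (\<lambda>x. (g x)\<^sup>2)"
  shows "integrable M (\<lambda>x. f x * g x)"
proof (rule Bochner_Integration.integrable_bound)
  show "integrable M (\<lambda>x. (f x)\<^sup>2 + (g x)\<^sup>2)" using assms by simp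
  have "\<bar>a * b\<bar> \<le> a\<^sup>2 + b\<^sup>2" for a b :: real
  proof -
    have "0 \<le> (\<bar>a\<bar> - \<bar>b\<bar>)\<^sup>2" "0 \<le> \<bar>a\<bar> * \<bar>b\<bar>" by auto
    then show ?thesis unfolding abs_mult power2_diff power2_abs by linarith
  qed
  then show "AE x in M. norm (f x * g x) \<le> norm ((f x)\<^sup>2 + (g x)\<^sup>2)"
    by (intro AE_I2) (metis real_norm_def abs_ge_self order_trans)
  show "(\<lambda>x. f x * g x) \<in> borel_measurable M" using assms(1,2) by (rule borel_measurable_times)
qed

text \<open>
  The Cauchy-Schwarz inequality in additive form, with a weight \<open>c\<close> to be chosen freely; it
  avoids square roots.
\<close>

lemma integral_mult_le_squares:
  fixes f g :: "'a \<Rightarrow> real"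
  assumes "f \<in> borel_measurable M" "g \<in> borel_measurable M"
    "integrable M (\<lambda>x. (f x)\<^sup>2)" "integrable M (\<lambda>x. (g x)\<^sup>2)" and c: "c > 0"
  shows "\<bar>\<integral>x. f x * g x \<partial>M\<bar> \<le> c * (\<integral>x. (f x)\<^sup>2 \<partial>M) + (\<integral>x. (g x)\<^sup>2 \<partial>M) / c"
proof -
  have "\<bar>\<integral>x. f x * g x \<partial>M\<bar> \<le> (\<integral>x. \<bar>f x * g x\<bar> \<partial>M)" by (rule integral_abs_bound)
  also have "\<dots> \<le> (\<integral>x. c * (f x)\<^sup>2 + (g x)\<^sup>2 / c \<partial>M)"
  proof (rule integral_mono)
    show "integrable M (\<lambda>x. \<bar>f x * g x\<bar>)" by (intro integrable_abs integrable_mult_of_squares assms)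
    show "integrable M (\<lambda>x. c * (f x)\<^sup>2 + (g x)\<^sup>2 / c)" using assms by auto
    fix x
    have "0 \<le> (c * \<bar>f x\<bar> - \<bar>g x\<bar>)\<^sup>2" by simp
    then have "2 * c * \<bar>f x * g x\<bar> \<le> c\<^sup>2 * (f x)\<^sup>2 + (g x)\<^sup>2"
      by (simp add: power2_diff abs_mult power_mult_distrib algebra_simps)
    moreover have "0 \<le> c * \<bar>f x * g x\<bar>" using c by simp
    ultimately have "c * \<bar>f x * g x\<bar> \<le> c\<^sup>2 * (f x)\<^sup>2 + (g x)\<^sup>2" by linarith
    also have "\<dots> = c * (c * (f x)\<^sup>2 + (g x)\<^sup>2 / c)" using c by (simp add: field_simps power2_eq_square)
    finally show "\<bar>f x * g x\<bar> \<le> c * (f x)\<^sup>2 + (g x)\<^sup>2 / c" using c by (simp only: mult_le_cancel_left_pos)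
  qed
  also have "\<dots> = c * (\<integral>x. (f x)\<^sup>2 \<partial>M) + (\<integral>x. (g x)\<^sup>2 \<partial>M) / c" using assms by simp
  finally show ?thesis .
qed

section \<open>The norm of the reproducing kernel Hilbert space\<close>

lemma space_finite_borel_measure_on: "finite_borel_measure_on T \<nu> \<Longrightarrow> space \<nu> = {0..T}"
  using sets_eq_imp_space_eq[of \<nu> "restrict_space borel {0..T}"]
  by (simp add: finite_borel_measure_on_def space_restrict_space)

text \<open>
  Exchanges expectation and integration in time. Fubini's theorem applies since the expected absolute value of
  \<open>D * U(t)\<close> is bounded uniformly in \<open>t\<close> by the second moment of \<open>D\<close>
  plus the variance of \<open>U(t)\<close>.
\<close>

lemma gaussian_integral_orthogonal:
  fixes U :: "'w \<Rightarrow> real \<Rightarrow> real"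
  assumes U: "continuous_gaussian_process N T U" and \<nu>: "finite_borel_measure_on T \<nu>"
    and D: "D \<in> borel_measurable N" "integrable N (\<lambda>w. (D w)\<^sup>2)"
    and orth: "\<And>t. t \<in> {0..T} \<Longrightarrow> (\<integral>w. U w t * D w \<partial>N) = 0"
  shows "integrable N (\<lambda>w. D w * (\<integral>t. U w t \<partial>\<nu>))" "(\<integral>w. D w * (\<integral>t. U w t \<partial>\<nu>) \<partial>N) = 0"
proof -
  interpret N: prob_space N using U by (simp add: continuous_gaussian_process_def)
  interpret \<nu>: finite_measure \<nu> using \<nu> by (simp add: finite_borel_measure_on_def)
  interpret pair_sigma_finite \<nu> N ..
  have sets: "sets \<nu> = sets (restrict_space borel {0..T})" using \<nu> by (simp add: finite_borel_measure_on_def)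
  note sp = space_finite_borel_measure_on[OF \<nu>]
  note meas = continuous_gaussian_process_measurable[OF U]
  have cont: "continuous_on {0..T} (U w)" if "w \<in> space N" for w
    using U that by (simp add: continuous_gaussian_process_def)
  obtain C where C: "\<And>t. t \<in> {0..T} \<Longrightarrow> integrable N (\<lambda>w. (U w t)\<^sup>2)"
    "\<And>t. t \<in> {0..T} \<Longrightarrow> (\<integral>w. (U w t)\<^sup>2 \<partial>N) \<le> C"
    using continuous_gaussian_process_bounded_variance[OF U] by blast
  have "(\<lambda>(w, t). U w t) \<in> borel_measurable (N \<Otimes>\<^sub>M \<nu>)"
    by (rule continuous_process_measurable_pair[OF meas cont sets])
  from measurable_pair_swap[OF this] have swap: "(\<lambda>p. U (snd p) (fst p)) \<in> borel_measurable (\<nu> \<Otimes>\<^sub>M N)"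
    by (simp add: case_prod_beta)
  have fm: "(\<lambda>(t, w). D w * U w t) \<in> borel_measurable (\<nu> \<Otimes>\<^sub>M N)"
    unfolding case_prod_beta
    by (rule borel_measurable_times[OF measurable_compose[OF measurable_snd D(1)] swap])
  have int: "integrable N (\<lambda>w. D w * U w t)" if t: "t \<in> {0..T}" for t
    by (rule integrable_mult_of_squares[OF D(1) meas[OF t] D(2) C(1)[OF t]])
  have fint: "integrable (\<nu> \<Otimes>\<^sub>M N) (\<lambda>(t, w). D w * U w t)"
  proof (rule Fubini_integrable[OF fm])
    show "integrable \<nu> (\<lambda>t. \<integral>w. norm (case (t, w) of (t, w) \<Rightarrow> D w * U w t) \<partial>N)"
      unfolding prod.case
    proof (rule \<nu>.integrable_const_bound)
      show "AE t in \<nu>. norm (\<integral>w. norm (D w * U w t) \<partial>N) \<le> (\<integral>w. (D w)\<^sup>2 \<partial>N) + C"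
      proof (rule AE_I2)
        fix t assume "t \<in> space \<nu>"
        then have t: "t \<in> {0..T}" by (simp add: sp)
        have "\<bar>\<integral>w. \<bar>D w\<bar> * \<bar>U w t\<bar> \<partial>N\<bar> \<le> 1 * (\<integral>w. \<bar>D w\<bar>\<^sup>2 \<partial>N) + (\<integral>w. \<bar>U w t\<bar>\<^sup>2 \<partial>N) / 1"
          by (rule integral_mult_le_squares)
            (use D C(1)[OF t] meas[OF t] in \<open>auto intro: borel_measurable_abs\<close>)
        then show "norm (\<integral>w. norm (D w * U w t) \<partial>N) \<le> (\<integral>w. (D w)\<^sup>2 \<partial>N) + C"
          using C(2)[OF t] by (simp add: abs_mult)
      qed
      show "(\<lambda>t. \<integral>w. norm (D w * U w t) \<partial>N) \<in> borel_measurable \<nu>"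
        by (rule N.borel_measurable_lebesgue_integral)
          (use measurable_compose[OF fm borel_measurable_norm] in \<open>simp add: case_prod_beta\<close>)
    qed
    show "AE t in \<nu>. integrable N (\<lambda>w. case (t, w) of (t, w) \<Rightarrow> D w * U w t)"
      by (rule AE_I2) (simp add: sp int)
  qed
  show "integrable N (\<lambda>w. D w * (\<integral>t. U w t \<partial>\<nu>))"
    using integrable_snd[OF fint] by simp
  have "(\<integral>w. D w * (\<integral>t. U w t \<partial>\<nu>) \<partial>N) = (\<integral>w. (\<integral>t. D w * U w t \<partial>\<nu>) \<partial>N)" by simp
  also have "\<dots> = (\<integral>t. (\<integral>w. D w * U w t \<partial>N) \<partial>\<nu>)" by (rule Fubini_integral[OF fint])
  also have "\<dots> = (\<integral>t. 0 \<partial>\<nu>)"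
    by (rule Bochner_Integration.integral_cong) (use orth in \<open>simp_all add: sp mult.commute\<close>)
  finally show "(\<integral>w. D w * (\<integral>t. U w t \<partial>\<nu>) \<partial>N) = 0" by simp
qed

lemma gaussian_integral_measurable:
  fixes U :: "'w \<Rightarrow> real \<Rightarrow> real"
  assumes U: "continuous_gaussian_process N T U" and \<nu>: "finite_borel_measure_on T \<nu>"
  shows "(\<lambda>w. \<integral>t. U w t \<partial>\<nu>) \<in> borel_measurable N"
proof -
  interpret \<nu>: finite_measure \<nu> using \<nu> by (simp add: finite_borel_measure_on_def)
  have sets: "sets \<nu> = sets (restrict_space borel {0..T})" using \<nu> by (simp add: finite_borel_measure_on_def)
  have cont: "continuous_on {0..T} (U w)" if "w \<in> space N" for w
    using U that by (simp add: continuous_gaussian_process_def)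
  show ?thesis
    by (rule \<nu>.borel_measurable_lebesgue_integral
        [OF continuous_process_measurable_pair[OF continuous_gaussian_process_measurable[OF U] cont sets]])
qed

lemma integrable_square_of_nn_integral:
  fixes f :: "'a \<Rightarrow> real"
  assumes "f \<in> borel_measurable M" "(\<integral>\<^sup>+x. ennreal ((f x)\<^sup>2) \<partial>M) < \<infinity>"
  shows "integrable M (\<lambda>x. (f x)\<^sup>2)" "(\<integral>\<^sup>+x. ennreal ((f x)\<^sup>2) \<partial>M) = ennreal (\<integral>x. (f x)\<^sup>2 \<partial>M)"
proof -
  show int: "integrable M (\<lambda>x. (f x)\<^sup>2)"
    using assms by (intro integrableI_nonneg) auto
  show "(\<integral>\<^sup>+x. ennreal ((f x)\<^sup>2) \<partial>M) = ennreal (\<integral>x. (f x)\<^sup>2 \<partial>M)"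
    by (rule nn_integral_eq_integral[OF int]) simp
qed

lemma gaussian_L2_spaceD:
  assumes "Y \<in> gaussian_L2_space N T U"
  shows "Y \<in> borel_measurable N" "integrable N (\<lambda>w. (Y w)\<^sup>2)"
  using assms integrable_square_of_nn_integral by (auto simp: gaussian_L2_space_def)

text \<open>
  Orthogonality to the process passes to integrals of the process and then, by continuity of the inner
  product, to their closure.
\<close>

lemma gaussian_L2_space_orthogonal:
  fixes U :: "'w \<Rightarrow> real \<Rightarrow> real"
  assumes U: "continuous_gaussian_process N T U" and Y: "Y \<in> gaussian_L2_space N T U"
    and D: "D \<in> borel_measurable N" "integrable N (\<lambda>w. (D w)\<^sup>2)"
    and orth: "\<And>t. t \<in> {0..T} \<Longrightarrow> (\<integral>w. U w t * D w \<partial>N) = 0"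
  shows "(\<integral>w. D w * Y w \<partial>N) = 0"
proof -
  define d where "d = (\<integral>w. (D w)\<^sup>2 \<partial>N)"
  have d: "d \<ge> 0" by (simp add: d_def)
  have "\<bar>\<integral>w. D w * Y w \<partial>N\<bar> \<le> \<eta>" if \<eta>: "\<eta> > 0" for \<eta>
  proof -
    \<comment> \<open>The weight makes the first term of the Cauchy-Schwarz bound at most \<open>\<eta> / 2\<close>; \<open>\<epsilon>\<close> is then chosen
      so that the second one is, too.\<close>
    define c where "c = \<eta> / (2 * (d + 1))"
    have c: "c > 0" using \<eta> d by (simp add: c_def)
    define \<epsilon> where "\<epsilon> = c * \<eta> / 2"
    have \<epsilon>: "\<epsilon> > 0" using c \<eta> by (simp add: \<epsilon>_def)
    obtain \<nu>1 \<nu>2 where \<nu>: "finite_borel_measure_on T \<nu>1" "finite_borel_measure_on T \<nu>2"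
      and less: "(\<integral>\<^sup>+w. ennreal ((Y w - ((\<integral>t. U w t \<partial>\<nu>1) - (\<integral>t. U w t \<partial>\<nu>2)))\<^sup>2) \<partial>N) < ennreal \<epsilon>"
      using Y \<epsilon> unfolding gaussian_L2_space_def by blast
    define V where "V w = (\<integral>t. U w t \<partial>\<nu>1) - (\<integral>t. U w t \<partial>\<nu>2)" for w
    have Vm: "V \<in> borel_measurable N"
      unfolding V_def by (intro borel_measurable_diff gaussian_integral_measurable[OF U] \<nu>)
    have Ym: "Y \<in> borel_measurable N" and Y2: "integrable N (\<lambda>w. (Y w)\<^sup>2)"
      using gaussian_L2_spaceD[OF Y] by auto
    have Rm: "(\<lambda>w. Y w - V w) \<in> borel_measurable N" by (rule borel_measurable_diff[OF Ym Vm])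
    have less': "(\<integral>\<^sup>+w. ennreal ((Y w - V w)\<^sup>2) \<partial>N) < ennreal \<epsilon>" using less by (simp add: V_def)
    then have "(\<integral>\<^sup>+w. ennreal ((Y w - V w)\<^sup>2) \<partial>N) < \<infinity>" by (rule order.strict_trans) simp
    note R = integrable_square_of_nn_integral[OF Rm this]
    have "(\<integral>w. (Y w - V w)\<^sup>2 \<partial>N) < \<epsilon>"
      using less' unfolding R(2) by (simp add: ennreal_less_iff)
    note o1 = gaussian_integral_orthogonal[OF U \<nu>(1) D orth] and o2 = gaussian_integral_orthogonal[OF U \<nu>(2) D orth]
    have DV: "integrable N (\<lambda>w. D w * V w)" "(\<integral>w. D w * V w \<partial>N) = 0"
      using o1 o2 by (simp_all add: V_def right_diff_distrib)
    have DR: "integrable N (\<lambda>w. D w * (Y w - V w))"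
      by (rule integrable_mult_of_squares[OF D(1) Rm D(2) R(1)])
    have "(\<integral>w. D w * Y w \<partial>N) = (\<integral>w. D w * V w + D w * (Y w - V w) \<partial>N)" by (simp add: algebra_simps)
    also have "\<dots> = (\<integral>w. D w * (Y w - V w) \<partial>N)" using DV DR by simp
    finally have "\<bar>\<integral>w. D w * Y w \<partial>N\<bar> = \<bar>\<integral>w. D w * (Y w - V w) \<partial>N\<bar>" by simp
    also have "\<dots> \<le> c * d + (\<integral>w. (Y w - V w)\<^sup>2 \<partial>N) / c"
      unfolding d_def by (rule integral_mult_le_squares[OF D(1) Rm D(2) R(1) c])
    also have "\<dots> \<le> \<eta> / 2 + \<eta> / 2"
    proof (rule add_mono)
      have "d / (d + 1) \<le> 1" using d by simp
      then have "\<eta> / 2 * (d / (d + 1)) \<le> \<eta> / 2 * 1" using \<eta> by (intro mult_left_mono) auto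
      then show "c * d \<le> \<eta> / 2" by (simp add: c_def)
      have "(\<integral>w. (Y w - V w)\<^sup>2 \<partial>N) \<le> \<eta> / 2 * c"
        using \<open>(\<integral>w. (Y w - V w)\<^sup>2 \<partial>N) < \<epsilon>\<close> by (simp add: \<epsilon>_def mult.commute)
      then show "(\<integral>w. (Y w - V w)\<^sup>2 \<partial>N) / c \<le> \<eta> / 2" using c by (simp add: pos_divide_le_eq)
    qed
    finally show ?thesis by simp
  qed
  then have "\<bar>\<integral>w. D w * Y w \<partial>N\<bar> \<le> 0" by (rule field_le_epsilon) simp
  then show ?thesis by simp
qed

text \<open>
  With \<open>D = Y - Y'\<close> orthogonal to both \<open>Y\<close> and \<open>Y'\<close>, both second
  moments equal the expectation of \<open>Y * Y'\<close>.
\<close>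

lemma rkhs_map_eq_imp_norm_eq:
  fixes U :: "'w \<Rightarrow> real \<Rightarrow> real"
  assumes U: "continuous_gaussian_process N T U"
    and Y: "Y \<in> gaussian_L2_space N T U" and Y': "Y' \<in> gaussian_L2_space N T U"
    and eq: "rkhs_map N T U Y = rkhs_map N T U Y'"
  shows "(\<integral>w. (Y w)\<^sup>2 \<partial>N) = (\<integral>w. (Y' w)\<^sup>2 \<partial>N)"
proof -
  note y = gaussian_L2_spaceD[OF Y] and y' = gaussian_L2_spaceD[OF Y']
  obtain C where C: "\<And>t. t \<in> {0..T} \<Longrightarrow> integrable N (\<lambda>w. (U w t)\<^sup>2)"
    using continuous_gaussian_process_bounded_variance[OF U] by blast
  define D where "D w = Y w - Y' w" for w
  have YY': "integrable N (\<lambda>w. Y w * Y' w)" by (rule integrable_mult_of_squares[OF y(1) y'(1) y(2) y'(2)])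
  have Dm: "D \<in> borel_measurable N" unfolding D_def by (rule borel_measurable_diff[OF y(1) y'(1)])
  have D2: "integrable N (\<lambda>w. (D w)\<^sup>2)"
    using y(2) y'(2) YY' by (simp add: D_def power2_diff mult.assoc)
  have orth: "(\<integral>w. U w t * D w \<partial>N) = 0" if t: "t \<in> {0..T}" for t
  proof -
    have "integrable N (\<lambda>w. U w t * Y w)" "integrable N (\<lambda>w. U w t * Y' w)"
      using integrable_mult_of_squares[OF continuous_gaussian_process_measurable[OF U t] _ C[OF t]] y y' by auto
    moreover have "(\<integral>w. U w t * Y w \<partial>N) = (\<integral>w. U w t * Y' w \<partial>N)"
      using fun_cong[OF eq, of t] t by (simp add: rkhs_map_def)
    ultimately show ?thesis by (simp add: D_def right_diff_distrib)
  qed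
  have "(\<integral>w. D w * Y w \<partial>N) = 0" by (rule gaussian_L2_space_orthogonal[OF U Y Dm D2 orth])
  moreover have "(\<integral>w. D w * Y' w \<partial>N) = 0" by (rule gaussian_L2_space_orthogonal[OF U Y' Dm D2 orth])
  moreover have "(\<integral>w. D w * Y w \<partial>N) = (\<integral>w. (Y w)\<^sup>2 - Y w * Y' w \<partial>N)"
    by (simp add: D_def power2_eq_square algebra_simps)
  moreover have "(\<integral>w. D w * Y' w \<partial>N) = (\<integral>w. Y w * Y' w - (Y' w)\<^sup>2 \<partial>N)"
    by (simp add: D_def power2_eq_square algebra_simps)
  moreover note y(2) y'(2) YY'
  ultimately show ?thesis by simp
qed

text \<open>The representative picked by the choice operator may be replaced by any other.\<close>

lemma rkhs_norm_sq_rkhs_map: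
  fixes U :: "'w \<Rightarrow> real \<Rightarrow> real"
  assumes U: "continuous_gaussian_process N T U" and Y: "Y \<in> gaussian_L2_space N T U"
  shows "rkhs_norm_sq N T U (rkhs_map N T U Y) = ennreal (\<integral>w. (Y w)\<^sup>2 \<partial>N)"
proof -
  define Y' where "Y' = (SOME Y'. Y' \<in> gaussian_L2_space N T U \<and> rkhs_map N T U Y' = rkhs_map N T U Y)"
  have "Y' \<in> gaussian_L2_space N T U \<and> rkhs_map N T U Y' = rkhs_map N T U Y"
    unfolding Y'_def by (rule someI[of _ Y]) (simp add: Y)
  then have "(\<integral>w. (Y' w)\<^sup>2 \<partial>N) = (\<integral>w. (Y w)\<^sup>2 \<partial>N)"
    using rkhs_map_eq_imp_norm_eq[OF U _ Y] by blast
  moreover have "rkhs_map N T U Y \<in> rkhs N T U" using Y by (simp add: rkhs_def)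
  ultimately show ?thesis by (simp add: rkhs_norm_sq_def Y'_def)
qed

lemma finite_borel_measure_on_scale:
  assumes \<nu>: "finite_borel_measure_on T \<nu>" and c: "c \<ge> 0"
  shows "finite_borel_measure_on T (density \<nu> (\<lambda>_. ennreal c))"
proof -
  interpret finite_measure \<nu> using \<nu> by (simp add: finite_borel_measure_on_def)
  have "finite_measure (density \<nu> (\<lambda>_. ennreal c))"
  proof (rule finite_measureI)
    show "emeasure (density \<nu> (\<lambda>_. ennreal c)) (space (density \<nu> (\<lambda>_. ennreal c))) \<noteq> \<infinity>"
      by (simp add: emeasure_density nn_integral_cmult_indicator ennreal_mult_eq_top_iff)
  qed
  then show ?thesis using \<nu> by (simp add: finite_borel_measure_on_def)
qed

lemma integral_scaled_path:
  assumes \<nu>: "finite_borel_measure_on T \<nu>" and c: "c \<ge> 0" and f: "continuous_on {0..T} (f :: real \<Rightarrow> real)"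
  shows "(\<integral>t. f t \<partial>density \<nu> (\<lambda>_. ennreal c)) = c * (\<integral>t. f t \<partial>\<nu>)"
proof -
  have sets: "sets \<nu> = sets (restrict_space borel {0..T})" using \<nu> by (simp add: finite_borel_measure_on_def)
  have "f \<in> borel_measurable (restrict_space borel {0..T})"
    by (rule borel_measurable_continuous_on_restrict[OF f])
  then have "f \<in> borel_measurable \<nu>" using measurable_cong_sets[OF sets refl] by blast
  then show ?thesis using c by (subst integral_density) simp_all
qed

text \<open>
  If integrals against \<open>\<nu>1\<close> and \<open>\<nu>2\<close> approximate \<open>Y\<close>, then
  integrals against their multiples by \<open>c\<close> approximate \<open>c * Y\<close>.
\<close>

lemma gaussian_L2_space_scale:
  fixes U :: "'w \<Rightarrow> real \<Rightarrow> real"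
  assumes U: "continuous_gaussian_process N T U" and Y: "Y \<in> gaussian_L2_space N T U" and c: "c > 0"
  shows "(\<lambda>w. c * Y w) \<in> gaussian_L2_space N T U"
  unfolding gaussian_L2_space_def
proof (intro CollectI conjI allI impI)
  have Ym: "Y \<in> borel_measurable N" by (rule gaussian_L2_spaceD[OF Y])
  then show "(\<lambda>w. c * Y w) \<in> borel_measurable N" by simp
  have scale: "(\<integral>\<^sup>+w. ennreal ((c * f w)\<^sup>2) \<partial>N) = ennreal (c\<^sup>2) * (\<integral>\<^sup>+w. ennreal ((f w)\<^sup>2) \<partial>N)"
    if f: "f \<in> borel_measurable N" for f
    using f by (subst nn_integral_cmult[symmetric]) (auto simp: power_mult_distrib ennreal_mult)
  have "(\<integral>\<^sup>+w. ennreal ((Y w)\<^sup>2) \<partial>N) < \<infinity>" using Y by (simp add: gaussian_L2_space_def)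
  then show "(\<integral>\<^sup>+w. ennreal ((c * Y w)\<^sup>2) \<partial>N) < \<infinity>"
    unfolding scale[OF Ym] by (simp add: ennreal_mult_less_top)
  fix \<epsilon> :: real assume \<epsilon>: "\<epsilon> > 0"
  define \<delta> where "\<delta> = \<epsilon> / c\<^sup>2"
  have "\<delta> > 0" using c \<epsilon> by (simp add: \<delta>_def)
  then obtain \<nu>1 \<nu>2 where \<nu>: "finite_borel_measure_on T \<nu>1" "finite_borel_measure_on T \<nu>2"
    and less: "(\<integral>\<^sup>+w. ennreal ((Y w - ((\<integral>t. U w t \<partial>\<nu>1) - (\<integral>t. U w t \<partial>\<nu>2)))\<^sup>2) \<partial>N) < ennreal \<delta>"
    using Y unfolding gaussian_L2_space_def by blast
  have cont: "continuous_on {0..T} (U w)" if "w \<in> space N" for w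
    using U that by (simp add: continuous_gaussian_process_def)
  let ?\<rho>1 = "density \<nu>1 (\<lambda>_. ennreal c)" and ?\<rho>2 = "density \<nu>2 (\<lambda>_. ennreal c)"
  define R where "R w = Y w - ((\<integral>t. U w t \<partial>\<nu>1) - (\<integral>t. U w t \<partial>\<nu>2))" for w
  have Rm: "R \<in> borel_measurable N"
    unfolding R_def by (intro borel_measurable_diff Ym gaussian_integral_measurable[OF U] \<nu>)
  have "(\<integral>\<^sup>+w. ennreal ((c * Y w - ((\<integral>t. U w t \<partial>?\<rho>1) - (\<integral>t. U w t \<partial>?\<rho>2)))\<^sup>2) \<partial>N)
      = (\<integral>\<^sup>+w. ennreal ((c * R w)\<^sup>2) \<partial>N)"
    using c by (intro nn_integral_cong)
      (simp add: integral_scaled_path[OF \<nu>(1) _ cont] integral_scaled_path[OF \<nu>(2) _ cont] R_def right_diff_distrib)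
  also have "\<dots> = ennreal (c\<^sup>2) * (\<integral>\<^sup>+w. ennreal ((R w)\<^sup>2) \<partial>N)" by (rule scale[OF Rm])
  also have "\<dots> < ennreal (c\<^sup>2) * ennreal \<delta>"
    using less c by (intro ennreal_mult_strict_left_mono) (auto simp: R_def)
  also have "\<dots> = ennreal \<epsilon>" using c by (simp add: \<delta>_def flip: ennreal_mult')
  finally have "(\<integral>\<^sup>+w. ennreal ((c * Y w - ((\<integral>t. U w t \<partial>?\<rho>1) - (\<integral>t. U w t \<partial>?\<rho>2)))\<^sup>2) \<partial>N) < ennreal \<epsilon>" .
  then show "\<exists>\<nu>1 \<nu>2. finite_borel_measure_on T \<nu>1 \<and> finite_borel_measure_on T \<nu>2 \<and>
      (\<integral>\<^sup>+w. ennreal ((c * Y w - ((\<integral>t. U w t \<partial>\<nu>1) - (\<integral>t. U w t \<partial>\<nu>2)))\<^sup>2) \<partial>N) < ennreal \<epsilon>"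
    using finite_borel_measure_on_scale \<nu> c by (intro exI[of _ ?\<rho>1] exI[of _ ?\<rho>2] conjI) auto
qed

lemma rkhs_map_scale:
  "rkhs_map N T U (\<lambda>w. c * Y w) = (\<lambda>t\<in>{0..T}. c * rkhs_map N T U Y t)"
  unfolding rkhs_map_def by (intro restrict_ext) (simp add: mult.left_commute)

lemma rkhs_scale:
  fixes U :: "'w \<Rightarrow> real \<Rightarrow> real"
  assumes "continuous_gaussian_process N T U" "h \<in> rkhs N T U" "c > 0"
  shows "(\<lambda>t\<in>{0..T}. c * h t) \<in> rkhs N T U"
  using assms gaussian_L2_space_scale[OF assms(1) _ assms(3)] rkhs_map_scale[of N T U c, symmetric]
  by (auto simp: rkhs_def)

text \<open>
  For \<open>h\<close> outside the space both sides are infinite; that the scaled path is then outside as well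
  is seen by scaling back, which recovers \<open>h\<close> because \<open>h\<close> is extensional.
\<close>

lemma rkhs_norm_sq_scale:
  fixes U :: "'w \<Rightarrow> real \<Rightarrow> real"
  assumes U: "continuous_gaussian_process N T U" and h: "h \<in> extensional {0..T}" and c: "c > 0"
  shows "rkhs_norm_sq N T U (\<lambda>t\<in>{0..T}. c * h t) = ennreal (c\<^sup>2) * rkhs_norm_sq N T U h"
proof (cases "h \<in> rkhs N T U")
  case True
  then obtain Y where Y: "Y \<in> gaussian_L2_space N T U" "h = rkhs_map N T U Y" by (auto simp: rkhs_def)
  have "rkhs_norm_sq N T U (\<lambda>t\<in>{0..T}. c * h t) = ennreal (\<integral>w. (c * Y w)\<^sup>2 \<partial>N)"
    unfolding Y(2) rkhs_map_scale[symmetric]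
    by (rule rkhs_norm_sq_rkhs_map[OF U gaussian_L2_space_scale[OF U Y(1) c]])
  also have "\<dots> = ennreal (c\<^sup>2) * ennreal (\<integral>w. (Y w)\<^sup>2 \<partial>N)"
    by (simp add: power_mult_distrib ennreal_mult')
  finally show ?thesis unfolding Y(2) rkhs_norm_sq_rkhs_map[OF U Y(1)] .
next
  case False
  have "(\<lambda>t\<in>{0..T}. c * h t) \<notin> rkhs N T U"
  proof
    assume *: "(\<lambda>t\<in>{0..T}. c * h t) \<in> rkhs N T U"
    have "(\<lambda>t\<in>{0..T}. (1 / c) * (\<lambda>t\<in>{0..T}. c * h t) t) \<in> rkhs N T U"
      by (rule rkhs_scale[OF U *]) (use c in simp)
    moreover have "(\<lambda>t\<in>{0..T}. (1 / c) * (\<lambda>t\<in>{0..T}. c * h t) t) = h"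
      by (rule extensionalityI[OF restrict_extensional h]) (use c in simp)
    ultimately show False using False by simp
  qed
  then show ?thesis using False c by (simp add: rkhs_norm_sq_def ennreal_mult_top)
qed

lemma gaussian_rate_eq: "gaussian_rate N T U h = ennreal (1 / 2) * rkhs_norm_sq N T U h"
  unfolding gaussian_rate_def by (cases "h \<in> rkhs N T U") (simp_all add: rkhs_norm_sq_def ennreal_mult_top)

lemma gaussian_rate_zero:
  fixes U :: "'w \<Rightarrow> real \<Rightarrow> real"
  assumes U: "continuous_gaussian_process N T U"
  shows "gaussian_rate N T U (\<lambda>t\<in>{0..T}. 0) = 0"
proof -
  \<comment> \<open>The zero variable is the integral against the zero measure.\<close>
  define \<nu> where "\<nu> = (null_measure (restrict_space borel {0..T}) :: real measure)"
  have "finite_borel_measure_on T \<nu>"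
    by (auto simp: finite_borel_measure_on_def \<nu>_def intro: finite_measureI)
  then have "(\<lambda>w. 0) \<in> gaussian_L2_space N T U"
    by (auto simp: gaussian_L2_space_def intro!: exI[of _ \<nu>])
  from rkhs_norm_sq_rkhs_map[OF U this] show ?thesis
    by (simp add: gaussian_rate_eq rkhs_map_def)
qed

text \<open>Homogeneity of the squared norm, applied with the factor \<open>1 / a\<close>.\<close>

lemma gaussian_rate_scaled_eq_conditional_rate:
  fixes U :: "'w \<Rightarrow> real \<Rightarrow> real"
  assumes U: "continuous_gaussian_process N T U" and a: "a > 0"
  shows "gaussian_rate N T U (\<lambda>t\<in>{0..T}. (z t - b t) / a) = conditional_rate N T U z a b"
proof -
  have "(\<lambda>t\<in>{0..T}. (z t - b t) / a) = (\<lambda>t\<in>{0..T}. (1 / a) * (\<lambda>t\<in>{0..T}. z t - b t) t)"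
    by (rule restrict_ext) simp
  then have "gaussian_rate N T U (\<lambda>t\<in>{0..T}. (z t - b t) / a)
      = ennreal (1 / 2) * (ennreal ((1 / a)\<^sup>2) * rkhs_norm_sq N T U (\<lambda>t\<in>{0..T}. z t - b t))"
    unfolding gaussian_rate_eq using a by (simp only: rkhs_norm_sq_scale[OF U restrict_extensional] zero_less_divide_1_iff)
  also have "\<dots> = ennreal (1 / 2 * (1 / a)\<^sup>2) * rkhs_norm_sq N T U (\<lambda>t\<in>{0..T}. z t - b t)"
  proof -
    have "ennreal (1 / 2 * (1 / a)\<^sup>2) = ennreal (1 / 2) * ennreal ((1 / a)\<^sup>2)"
      by (rule ennreal_mult') simp
    then show ?thesis by (simp only: mult.assoc)
  qed
  also have "1 / 2 * (1 / a)\<^sup>2 = 1 / (2 * a\<^sup>2)" by (simp add: power_divide)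
  finally show ?thesis using a by (simp only: conditional_rate_def if_True)
qed

section \<open>The affine transformation of a Gaussian process\<close>

lemma vimage_algebra_component_subset:
  assumes F: "\<And>w n. w \<in> \<Omega> \<Longrightarrow> F n w \<in> space S"
  shows "sets (vimage_algebra \<Omega> (F n) S) \<subseteq> sets (vimage_algebra \<Omega> (\<lambda>w n. F n w) (PiM UNIV (\<lambda>n::nat. S)))"
proof
  let ?P = "PiM UNIV (\<lambda>n::nat. S)"
  fix E assume "E \<in> sets (vimage_algebra \<Omega> (F n) S)"
  then obtain A where A: "A \<in> sets S" "E = F n -` A \<inter> \<Omega>"
    using F by (subst (asm) sets_vimage_algebra2) auto
  have "(\<lambda>f. f n) -` A \<inter> space ?P \<in> sets ?P"
    using A(1) by (intro measurable_sets[where A = S] measurable_component_singleton) auto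
  moreover have "E = (\<lambda>w n. F n w) -` ((\<lambda>f. f n) -` A \<inter> space ?P) \<inter> \<Omega>"
    using A(2) F by (auto simp: space_PiM)
  ultimately show "E \<in> sets (vimage_algebra \<Omega> (\<lambda>w n. F n w) ?P)"
    using in_vimage_algebra by blast
qed

text \<open>
  Independence of two sequences restricts to their \<open>n\<close>-th terms, as coordinate projections are
  measurable.
\<close>

lemma indep_elements_component:
  assumes M: "prob_space M"
    and ind: "indep_elements M (PiM UNIV (\<lambda>n::nat. S)) (\<lambda>w n. F n w) (PiM UNIV (\<lambda>n::nat. R)) (\<lambda>w n. G n w)"
    and F: "\<And>n. F n \<in> measurable M S" and G: "\<And>n. G n \<in> measurable M R"
  shows "indep_elements M S (F n) R (G n)"
proof -
  interpret prob_space M by fact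
  have "sets (vimage_algebra (space M) (F n) S)
      \<subseteq> sets (vimage_algebra (space M) (\<lambda>w n. F n w) (PiM UNIV (\<lambda>n. S)))"
    "sets (vimage_algebra (space M) (G n) R)
      \<subseteq> sets (vimage_algebra (space M) (\<lambda>w n. G n w) (PiM UNIV (\<lambda>n. R)))"
    using F G by (intro vimage_algebra_component_subset; blast dest: measurable_space)+
  with ind show ?thesis
    unfolding indep_elements_def indep_set_def
    by (elim indep_sets_mono_sets) (auto split: bool.split)
qed

text \<open>
  The infimum over the fibre of the affine map above \<open>((a, b), z)\<close>. The fibre is a point for
  \<open>a > 0\<close>. For \<open>a = 0\<close> it is either empty, with infimum \<open>\<infinity>\<close>,
  or all \<open>((0, b), x)\<close>, with the infimum attained at the zero path.
\<close>

lemma affine_image_rate: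
  fixes N :: "'p::finite \<Rightarrow> 'u measure" and U :: "'p \<Rightarrow> 'u \<Rightarrow> real \<Rightarrow> real"
    and z b :: "real \<Rightarrow> real ^ 'p"
  assumes U: "\<And>i. continuous_gaussian_process (N i) T (U i)"
    and a: "a \<ge> 0" and b: "b \<in> topspace (path_top T)" and z: "z \<in> topspace (path_top T)"
  shows "(INF p\<in>{p \<in> topspace (prod_topology (scale_path_top T) (path_top T)).
        (fst p, (\<lambda>((a, b), x). \<lambda>t\<in>{0..T}. a *\<^sub>R x t + b t) p) = ((a, b), z)}.
      (\<lambda>(ab, x). I ab + (\<Sum>i\<in>UNIV. gaussian_rate (N i) T (U i) (path_comp T x i))) p)
    = I (a, b) + (\<Sum>i\<in>UNIV. conditional_rate (N i) T (U i) (path_comp T z i) a (path_comp T b i))"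
    (is "(INF p\<in>?S. ?I p) = ?R")
proof (cases "a > 0")
  case True
  define x where "x = (\<lambda>t\<in>{0..T}. (1 / a) *\<^sub>R (z t - b t))"
  have x: "x \<in> topspace (path_top T)"
    unfolding x_def using b z by (intro restrict_in_path_top continuous_intros) (simp_all add: topspace_path_top)
  have ext: "z \<in> extensional {0..T}" using z by (simp add: topspace_path_top)
  have "?S = {((a, b), x)}"
  proof
    show "{((a, b), x)} \<subseteq> ?S"
    proof -
      have "(\<lambda>t\<in>{0..T}. a *\<^sub>R x t + b t) = z"
        by (rule extensionalityI[OF restrict_extensional ext]) (use True in \<open>simp add: x_def\<close>)
      then show ?thesis using a b x by (simp add: scale_path_top_def)
    qed
    show "?S \<subseteq> {((a, b), x)}"
    proof
      fix p assume p: "p \<in> ?S"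
      then obtain y where y: "p = ((a, b), y)" by (cases p) auto
      have y_ext: "y \<in> extensional {0..T}" and eq: "(\<lambda>t\<in>{0..T}. a *\<^sub>R y t + b t) = z"
        using p by (auto simp: y topspace_path_top)
      have "y = x"
      proof (rule extensionalityI[OF y_ext])
        show "x \<in> extensional {0..T}" by (simp add: x_def)
        show "y t = x t" if "t \<in> {0..T}" for t
          using True that by (simp add: x_def eq[symmetric])
      qed
      then show "p \<in> {((a, b), x)}" by (simp add: y)
    qed
  qed
  moreover have "gaussian_rate (N i) T (U i) (path_comp T x i)
      = conditional_rate (N i) T (U i) (path_comp T z i) a (path_comp T b i)" for i
  proof -
    have "path_comp T x i = (\<lambda>t\<in>{0..T}. (path_comp T z i t - path_comp T b i t) / a)"
      unfolding path_comp_def by (rule restrict_ext) (simp add: x_def)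
    then show ?thesis by (simp only: gaussian_rate_scaled_eq_conditional_rate[OF U True])
  qed
  ultimately show ?thesis by simp
next
  case False
  then have a0: "a = 0" using a by simp
  show ?thesis
  proof (cases "z = b")
    case True
    define x0 where "x0 = (\<lambda>t\<in>{0..T}. 0 :: real ^ 'p)"
    have x0: "x0 \<in> topspace (path_top T)"
      unfolding x0_def by (intro restrict_in_path_top continuous_intros)
    have "path_comp T x0 i = (\<lambda>t\<in>{0..T}. 0)" for i
      unfolding path_comp_def by (rule restrict_ext) (simp add: x0_def)
    then have rate_x0: "(\<Sum>i\<in>UNIV. gaussian_rate (N i) T (U i) (path_comp T x0 i)) = 0"
      using gaussian_rate_zero[OF U] by simp
    have "(\<lambda>t\<in>{0..T}. b t) = b" using b by (simp add: topspace_path_top extensional_restrict)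
    then have x0S: "((a, b), x0) \<in> ?S" using x0 b True by (simp add: a0 scale_path_top_def)
    have "(INF p\<in>?S. ?I p) = I (a, b)"
    proof (rule antisym)
      have "(INF p\<in>?S. ?I p) \<le> ?I ((a, b), x0)" by (rule INF_lower[OF x0S])
      then show "(INF p\<in>?S. ?I p) \<le> I (a, b)" by (simp add: rate_x0)
      show "I (a, b) \<le> (INF p\<in>?S. ?I p)" by (rule INF_greatest) auto
    qed
    moreover have "?R = I (a, b)" using True by (simp add: conditional_rate_def a0)
    ultimately show ?thesis by simp
  next
    case neq: False
    have S_empty: "?S = {}"
    proof (rule ccontr)
      assume "?S \<noteq> {}"
      then have "z = (\<lambda>t\<in>{0..T}. b t)" by (auto simp: a0)
      then show False using neq b by (simp add: topspace_path_top extensional_restrict)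
    qed
    obtain i t where it: "t \<in> {0..T}" "z t $ i \<noteq> b t $ i"
    proof -
      have "\<exists>t\<in>{0..T}. z t \<noteq> b t"
        using neq b z extensionalityI[of z "{0..T}" b] by (auto simp: topspace_path_top)
      then show thesis using that by (auto simp: vec_eq_iff)
    qed
    then have "conditional_rate (N i) T (U i) (path_comp T z i) a (path_comp T b i) = \<infinity>"
      by (auto simp: conditional_rate_def path_comp_def a0)
    then have R_top: "?R = \<infinity>" by (subst sum.remove[of _ i]) auto
    show ?thesis unfolding S_empty R_top by simp
  qed
qed

theorem theorem3p1:
  fixes M :: "'w measure" and T :: real and \<gamma> :: "nat \<Rightarrow> real"
    and X :: "nat \<Rightarrow> 'w \<Rightarrow> real \<Rightarrow> real ^ 'p"
    and N :: "'p \<Rightarrow> 'u measure" and U :: "'p \<Rightarrow> 'u \<Rightarrow> real \<Rightarrow> real"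
    and k :: "'p \<Rightarrow> real \<Rightarrow> real \<Rightarrow> real"
    and A :: "nat \<Rightarrow> 'w \<Rightarrow> real" and B :: "nat \<Rightarrow> 'w \<Rightarrow> real \<Rightarrow> real ^ 'p"
    and I_AB :: "real \<times> (real \<Rightarrow> real ^ 'p) \<Rightarrow> ennreal"
    and Z :: "nat \<Rightarrow> 'w \<Rightarrow> real \<Rightarrow> real ^ 'p"
  assumes T: "T > 0"
    and M: "prob_space M"
    and X_gaussian: "\<And>n. continuous_gaussian_process M T (X n)"
    and X_zero: "\<And>n. AE \<omega> in M. X n \<omega> 0 = 0"
    and X_components: "\<And>n. independent_components M T (X n)"
    and U_gaussian: "\<And>i. continuous_gaussian_process (N i) T (U i)"
    and U_covariance: "\<And>i. has_covariance (N i) T (U i) (k i)"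
    and X_ldp: "ldp_elements M (path_top T) \<gamma> X
          (\<lambda>h. \<Sum>i\<in>UNIV. gaussian_rate (N i) T (U i) (path_comp T h i))"
    and X_good: "good_rate_function (path_top T)
          (\<lambda>h. \<Sum>i\<in>UNIV. gaussian_rate (N i) T (U i) (path_comp T h i))"
    and AB_ldp: "ldp_elements M (scale_path_top T) \<gamma> (\<lambda>n \<omega>. (A n \<omega>, B n \<omega>)) I_AB"
    and AB_good: "good_rate_function (scale_path_top T) I_AB"
    and indep: "indep_elements M
          (PiM UNIV (\<lambda>n::nat. borel_of (scale_path_top T))) (\<lambda>\<omega> n. (A n \<omega>, B n \<omega>))
          (PiM UNIV (\<lambda>n::nat. borel_of (path_top T))) (\<lambda>\<omega> n. X n \<omega>)"
    and Z: "\<And>n \<omega>. \<omega> \<in> space M \<Longrightarrow> Z n \<omega> = (\<lambda>t\<in>{0..T}. A n \<omega> *\<^sub>R X n \<omega> t + B n \<omega> t)"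
  shows "ldp_elements M (prod_topology (scale_path_top T) (path_top T)) \<gamma>
           (\<lambda>n \<omega>. ((A n \<omega>, B n \<omega>), Z n \<omega>))
           (\<lambda>((a, b), z). I_AB (a, b) +
              (\<Sum>i\<in>UNIV. conditional_rate (N i) T (U i) (path_comp T z i) a (path_comp T b i)))
       \<and> ldp_elements M (path_top T) \<gamma> Z
           (\<lambda>z. INF (a, b)\<in>topspace (scale_path_top T). I_AB (a, b) +
              (\<Sum>i\<in>UNIV. conditional_rate (N i) T (U i) (path_comp T z i) a (path_comp T b i)))
       \<and> good_rate_function (path_top T)
           (\<lambda>z. INF (a, b)\<in>topspace (scale_path_top T). I_AB (a, b) +
              (\<Sum>i\<in>UNIV. conditional_rate (N i) T (U i) (path_comp T z i) a (path_comp T b i)))"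
proof -
  let ?S = "scale_path_top T :: (real \<times> (real \<Rightarrow> real ^ 'p)) topology"
  let ?P = "path_top T :: (real \<Rightarrow> real ^ 'p) topology"
  let ?E = "prod_topology ?S ?P"
  let ?g = "\<lambda>((a, b), x). \<lambda>t\<in>{0..T}. a *\<^sub>R x t + b t :: real ^ 'p"
  let ?f = "\<lambda>p. (fst p, ?g p)"
  let ?I_X = "\<lambda>h. \<Sum>i\<in>UNIV. gaussian_rate (N i) T (U i) (path_comp T h i)"
  let ?J = "\<lambda>((a, b), z). I_AB (a, b) +
      (\<Sum>i\<in>UNIV. conditional_rate (N i) T (U i) (path_comp T z i) a (path_comp T b i))"
  have reg: "regular_space ?S" "regular_space ?P" and Haus: "Hausdorff_space ?P" "Hausdorff_space ?E"
    by (simp_all add: metrizable_imp_regular_space metrizable_imp_Hausdorff_space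
        Hausdorff_space_prod_topology metrizable_path_top metrizable_scale_path_top)
  note AB_meas = ldp_elementsD(1)[OF M AB_ldp] and X_meas = ldp_elementsD(1)[OF M X_ldp]
  have pair_ldp: "ldp_elements M ?E \<gamma> (\<lambda>n \<omega>. ((A n \<omega>, B n \<omega>), X n \<omega>)) (\<lambda>(ab, x). I_AB ab + ?I_X x)"
    by (rule ldp_elements_Pair[OF M AB_ldp X_ldp AB_good X_good reg(1) second_countable_scale_path_top
          reg(2) second_countable_path_top indep_elements_component[OF M indep AB_meas X_meas]])
  have pair_good: "good_rate_function ?E (\<lambda>(ab, x). I_AB ab + ?I_X x)"
    by (rule good_rate_function_add[OF AB_good X_good])
  have f: "continuous_map ?E ?E ?f"
    by (intro continuous_map_paired[THEN iffD2] conjI continuous_map_fst continuous_map_affine_path)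
  note joint = ldp_elements_contraction[OF M pair_ldp pair_good f Haus(2)]
  have J: "(INF p\<in>{p \<in> topspace ?E. ?f p = q}. (\<lambda>(ab, x). I_AB ab + ?I_X x) p) = ?J q"
    if "q \<in> topspace ?E" for q
  proof -
    obtain a b z where q: "q = ((a, b), z)" by (cases q, cases "fst q") auto
    have "a \<ge> 0" "b \<in> topspace ?P" "z \<in> topspace ?P" using that by (auto simp: q scale_path_top_def)
    from affine_image_rate[OF U_gaussian this, of I_AB] show ?thesis unfolding q prod.case .
  qed
  have joint_ldp: "ldp_elements M ?E \<gamma> (\<lambda>n \<omega>. ((A n \<omega>, B n \<omega>), Z n \<omega>)) ?J"
    by (rule iffD1[OF ldp_elements_cong[OF M J] joint(1)]) (simp_all add: Z)
  have joint_good: "good_rate_function ?E ?J"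
    by (rule iffD1[OF good_rate_function_cong[OF J] joint(2)])
  note marginal = ldp_elements_contraction[OF M joint_ldp joint_good continuous_map_snd Haus(1)]
  have K: "(INF p\<in>{p \<in> topspace ?E. snd p = z}. ?J p) = (INF (a, b)\<in>topspace ?S. ?J ((a, b), z))"
    if "z \<in> topspace ?P" for z
  proof -
    have "{p \<in> topspace ?E. snd p = z} = (\<lambda>ab. (ab, z)) ` topspace ?S" using that by auto
    then show ?thesis by (simp add: image_image case_prod_beta)
  qed
  have "ldp_elements M ?P \<gamma> Z (\<lambda>z. INF (a, b)\<in>topspace ?S. ?J ((a, b), z))"
    by (rule iffD1[OF ldp_elements_cong[OF M K] marginal(1)]) simp_all
  moreover have "good_rate_function ?P (\<lambda>z. INF (a, b)\<in>topspace ?S. ?J ((a, b), z))"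
    by (rule iffD1[OF good_rate_function_cong[OF K] marginal(2)])
  ultimately show ?thesis using joint_ldp unfolding prod.case by blast
qed

end
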